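(* Let $0<s<1$, let $D\subset\mathbb{R}^n$ be a domain and let $0<\beta<|D|$. Let $\hat f\in\bar{\mathcal R}_\beta$ be the unique minimizer of $\Phi_s$ over $\bar{\mathcal R}_\beta$, let $\hat u:=u_{\hat f}\in H^s_0(D)$, and let $\alpha>0$ be the constant such that $\{\hat f<1\}\subset\{\hat u=\alpha\}$, $\{\hat u<\alpha\}\subset\{\hat f=1\}$, $\hat f>0$ and $0\le\hat u\le\alpha$ in $D$. Then the function $\hat U:=\alpha-\hat u$ minimizes the functional $$J(v)=|v|_s^2+\int_Dv^+\,dx$$ over the set $H_\alpha=\{v\in H^s_{loc}(\mathbb{R}^n):v-\alpha\in H^s_0(D)\}$. Moreover, $U=\hat U$ satisfies the inequalities $$\chi_{\{U>0\}}\le-(-\Delta)^sU\le\chi_{\{U\ge0\}}\quad\text{in }D$$ in the sense of distributions. Finally, the minimizer of $J$ in $H_\alpha$ is unique and is the unique solution $U\in H_\alpha$ of these inequalities.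
   Context: Notation: $|u|_s^2:=\iint_{\mathbb{R}^{2n}}\frac{|u(x)-u(y)|^2}{|x-y|^{n+2s}}\,dx\,dy$; $H^s(\mathbb{R}^n)=\{v\in L^2(\mathbb{R}^n):|v|_s^2<\infty\}$; $H^s_{loc}(\mathbb{R}^n)$ is the set of functions $v$ with $\eta v\in H^s(\mathbb{R}^n)$ for every $\eta\in C_c^\infty(\mathbb{R}^n)$; $H^s_0(D)=\{v\in H^s(\mathbb{R}^n):v=0\text{ a.e. in }D^c\}$, $D^c=\mathbb{R}^n\setminus D$; $v^+=\max\{v,0\}$. For $f\in L^2(D)$, $u_f\in H^s_0(D)$ is the unique function with $$\frac12\iint_{\mathbb{R}^{2n}}\frac{(u_f(x)-u_f(y))(v(x)-v(y))}{|x-y|^{n+2s}}\,dx\,dy=\int_Dfv\,dx\quad\text{for all }v\in H^s_0(D)$$ (weak solution of $(-\Delta)^su_f=f$ in $D$, $u_f=0$ in $D^c$). $\Phi_s(f):=|u_f|_s^2$ and $\bar{\mathcal R}_\beta=\{f\in L^\infty(D):0\le f\le1,\ \int_Df\,dx=\beta\}$. A unique minimizer $\hat f$ of $\Phi_s$ over $\bar{\mathcal R}_\beta$ and a constant $\alpha$ with the listed properties exist. The fractional Laplacian is $(-\Delta)^su(x)=\text{p.v.}\int_{\mathbb{R}^n}\frac{u(x)-u(y)}{|x-y|^{n+2s}}\,dy$, acting weakly by $$\langle(-\Delta)^sU,\phi\rangle=\frac12\iint_{\mathbb{R}^{2n}}\frac{(U(x)-U(y))(\phi(x)-\phi(y))}{|x-y|^{n+2s}}\,dx\,dy.$$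 The inequalities in the sense of distributions mean: $\int_D\chi_{\{U>0\}}\phi\,dx\le-\langle(-\Delta)^sU,\phi\rangle\le\int_D\chi_{\{U\ge0\}}\phi\,dx$ for all $\phi\in C_c^\infty(D)$ with $\phi\ge0$.
   Formalization: J is taken as (1/4)|v|_s^2 + int_D v^+, since coefficient 1 contradicts the stated normalizations; and uniqueness of the solution of the inequalities is claimed only when C_c^infty(D) is dense in H^s_0(D), as it fails otherwise (e.g. a slit disc with s>1/2). *)

theory Defs
  imports "HOL-Analysis.Analysis"
begin

text \<open>
  Elements of Lebesgue and Sobolev spaces are represented by Lebesgue measurable functions on the
  whole space; equalities between them, and pointwise conditions on them, are understood up to
  null sets. On the diagonal the Gagliardo kernels below are \<open>0 / 0 = 0\<close>; the diagonal is a null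
  set of the product measure.
\<close>

section \<open>Fractional Sobolev spaces\<close>

definition gagliardo_sq :: "real \<Rightarrow> ('a::euclidean_space \<Rightarrow> real) \<Rightarrow> ennreal" where
  "gagliardo_sq s u =
     (\<integral>\<^sup>+ z. ennreal ((u (fst z) - u (snd z))\<^sup>2
               / norm (fst z - snd z) powr (real DIM('a) + 2 * s)) \<partial>(lebesgue \<Otimes>\<^sub>M lebesgue))"

definition Hs :: "real \<Rightarrow> ('a::euclidean_space \<Rightarrow> real) set" where
  "Hs s = {v. v \<in> borel_measurable lebesgue \<and> integrable lebesgue (\<lambda>x. (v x)\<^sup>2)
             \<and> gagliardo_sq s v < \<infinity>}"

definition Hs0 :: "real \<Rightarrow> 'a::euclidean_space set \<Rightarrow> ('a \<Rightarrow> real) set" where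
  "Hs0 s D = {v \<in> Hs s. AE x in lebesgue. x \<notin> D \<longrightarrow> v x = 0}"

primrec C_k :: "nat \<Rightarrow> ('a::euclidean_space \<Rightarrow> real) \<Rightarrow> bool" where
  "C_k 0 f \<longleftrightarrow> continuous_on UNIV f"
| "C_k (Suc k) f \<longleftrightarrow> (\<forall>x. f differentiable (at x))
                   \<and> (\<forall>i\<in>Basis. C_k k (\<lambda>x. frechet_derivative f (at x) i))"

definition Cc_inf :: "'a::euclidean_space set \<Rightarrow> ('a \<Rightarrow> real) set" where
  "Cc_inf D = {\<phi>. (\<forall>k. C_k k \<phi>) \<and> compact (closure {x. \<phi> x \<noteq> 0})
                    \<and> closure {x. \<phi> x \<noteq> 0} \<subseteq> D}"

definition Hs_loc :: "real \<Rightarrow> ('a::euclidean_space \<Rightarrow> real) set" where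
  "Hs_loc s = {v. \<forall>\<eta>\<in>Cc_inf UNIV. (\<lambda>x. \<eta> x * v x) \<in> Hs s}"

text \<open>Density of the test functions with respect to the squared norm of \<open>Hs s\<close>. It holds for
  bounded Lipschitz domains, but not for every domain: for \<open>s > 1/2\<close> it fails for a planar disc
  with a slit.\<close>

definition test_functions_dense :: "real \<Rightarrow> 'a::euclidean_space set \<Rightarrow> bool" where
  "test_functions_dense s D \<longleftrightarrow>
     (\<forall>v\<in>Hs0 s D. \<forall>\<epsilon>>0. \<exists>\<phi>\<in>Cc_inf D.
        (\<integral>\<^sup>+ x. ennreal ((v x - \<phi> x)\<^sup>2) \<partial>lebesgue) + gagliardo_sq s (\<lambda>x. v x - \<phi> x) < ennreal \<epsilon>)"

section \<open>The fractional Dirichlet problem and the rearrangement problem\<close>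

text \<open>The weak action of the fractional Laplacian of \<open>U\<close> on \<open>\<phi>\<close>.\<close>

definition frac_lap :: "real \<Rightarrow> ('a::euclidean_space \<Rightarrow> real) \<Rightarrow> ('a \<Rightarrow> real) \<Rightarrow> real" where
  "frac_lap s U \<phi> =
     1 / 2 * (\<integral> z. (U (fst z) - U (snd z)) * (\<phi> (fst z) - \<phi> (snd z))
               / norm (fst z - snd z) powr (real DIM('a) + 2 * s) \<partial>(lebesgue \<Otimes>\<^sub>M lebesgue))"

definition weak_solution ::
  "real \<Rightarrow> 'a::euclidean_space set \<Rightarrow> ('a \<Rightarrow> real) \<Rightarrow> ('a \<Rightarrow> real) \<Rightarrow> bool" where
  "weak_solution s D f u \<longleftrightarrow>
     u \<in> Hs0 s D \<and> (\<forall>v\<in>Hs0 s D. frac_lap s u v = (LINT x:D|lebesgue. f x * v x))"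

text \<open>Weak solutions are unique only up to null sets, hence a choice of representative;
  \<open>gagliardo_sq\<close> does not depend on it.\<close>

definition Phi :: "real \<Rightarrow> 'a::euclidean_space set \<Rightarrow> ('a \<Rightarrow> real) \<Rightarrow> ennreal" where
  "Phi s D f = gagliardo_sq s (SOME u. weak_solution s D f u)"

text \<open>Membership in \<open>L\<^sup>\<infinity>(D)\<close> is measurability, which is part of \<open>set_integrable\<close>, together with
  the bounds.\<close>

definition R_bar :: "'a::euclidean_space set \<Rightarrow> real \<Rightarrow> ('a \<Rightarrow> real) set" where
  "R_bar D \<beta> = {f. set_integrable lebesgue D f
                 \<and> (AE x in lebesgue. x \<in> D \<longrightarrow> 0 \<le> f x \<and> f x \<le> 1)
                 \<and> (LINT x:D|lebesgue. f x) = \<beta>}"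

definition minimizes_over :: "('b \<Rightarrow> ennreal) \<Rightarrow> 'b set \<Rightarrow> 'b \<Rightarrow> bool" where
  "minimizes_over F A a \<longleftrightarrow> a \<in> A \<and> (\<forall>b\<in>A. F a \<le> F b)"

section \<open>The obstacle-type functional and its inequalities\<close>

text \<open>The coefficient \<open>1/4\<close> is forced by the normalizations above: the derivative of
  \<open>gagliardo_sq s\<close> at \<open>v\<close> in direction \<open>\<phi>\<close> is \<open>4 * frac_lap s v \<phi>\<close>, so that with it the
  Euler--Lagrange inequalities of \<open>J\<close> are exactly those in \<open>obstacle_ineqs\<close>.\<close>

definition J :: "real \<Rightarrow> 'a::euclidean_space set \<Rightarrow> ('a \<Rightarrow> real) \<Rightarrow> ennreal" where
  "J s D v = 1 / 4 * gagliardo_sq s v + (\<integral>\<^sup>+ x\<in>D. ennreal (max (v x) 0) \<partial>lebesgue)"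

definition H_shift :: "real \<Rightarrow> 'a::euclidean_space set \<Rightarrow> real \<Rightarrow> ('a \<Rightarrow> real) set" where
  "H_shift s D \<alpha> = {v \<in> Hs_loc s. (\<lambda>x. v x - \<alpha>) \<in> Hs0 s D}"

definition obstacle_ineqs :: "real \<Rightarrow> 'a::euclidean_space set \<Rightarrow> ('a \<Rightarrow> real) \<Rightarrow> bool" where
  "obstacle_ineqs s D U \<longleftrightarrow>
     (\<forall>\<phi>\<in>Cc_inf D. (\<forall>x. 0 \<le> \<phi> x) \<longrightarrow>
        (LINT x:D|lebesgue. indicator {x. U x > 0} x * \<phi> x) \<le> - frac_lap s U \<phi> \<and>
        - frac_lap s U \<phi> \<le> (LINT x:D|lebesgue. indicator {x. U x \<ge> 0} x * \<phi> x))"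

end

theory Submission
  imports Defs
begin

text \<open>Write \<open>v = \<alpha> - w\<close> with \<open>w \<in> Hs0 s D\<close>. Since \<open>0 \<le> f \<le> 1\<close> in \<open>D\<close>, the integral of \<open>v\<^sup>+\<close> over \<open>D\<close> is
  at least that of \<open>f (\<alpha> - w)\<close>, which the equation for \<open>u\<close> turns into \<open>\<alpha> \<beta> - frac_lap s u w\<close>.
  Completing the square gives \<open>J v \<ge> \<alpha> \<beta> - frac_lap s u u / 2 + gagliardo_sq s (w - u) / 4\<close>, with
  equality for \<open>w = u\<close> because \<open>f = 1\<close> where \<open>u < \<alpha>\<close>; this yields minimality and uniqueness of the
  minimizer. The obstacle inequalities say that \<open>f\<close> lies between the two indicator functions.
  Uniqueness for the inequalities is a comparison argument, tested with \<open>(w - u)\<^sup>+\<close> and \<open>(u - w)\<^sup>+\<close>;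
  the indicator functions are square integrable there, since \<open>u = \<alpha>\<close> where \<open>f < 1\<close> forces \<open>D\<close> to
  have finite measure.\<close>

section \<open>Square integrable functions\<close>

text \<open>Functions rather than classes modulo null sets. The measure is a parameter because the
  same facts serve functions on the space and difference quotients on the product space.\<close>

definition L2 :: "'b measure \<Rightarrow> ('b \<Rightarrow> real) set" where
  "L2 M = {f \<in> borel_measurable M. integrable M (\<lambda>x. (f x)\<^sup>2)}"

lemma L2_measurable[measurable_dest]: "f \<in> L2 M \<Longrightarrow> f \<in> borel_measurable M"
  by (simp add: L2_def)

lemma L2_integrable_sq: "f \<in> L2 M \<Longrightarrow> integrable M (\<lambda>x. (f x)\<^sup>2)"
  by (simp add: L2_def)

lemma L2_integrable_mult:
  assumes [measurable]: "f \<in> L2 M" "g \<in> L2 M"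
  shows "integrable M (\<lambda>x. f x * g x)"
proof (rule Bochner_Integration.integrable_bound)
  show "integrable M (\<lambda>x. (f x)\<^sup>2 + (g x)\<^sup>2)"
    using assms by (simp add: L2_integrable_sq)
  show "AE x in M. norm (f x * g x) \<le> norm ((f x)\<^sup>2 + (g x)\<^sup>2)"
  proof (rule AE_I2)
    fix x
    have "0 \<le> (\<bar>f x\<bar> - \<bar>g x\<bar>)\<^sup>2" by simp
    then have "2 * \<bar>f x * g x\<bar> \<le> (f x)\<^sup>2 + (g x)\<^sup>2"
      by (simp add: power2_diff abs_mult)
    then show "norm (f x * g x) \<le> norm ((f x)\<^sup>2 + (g x)\<^sup>2)"
      by simp
  qed
qed measurable

lemma L2_mono:
  assumes g: "g \<in> L2 M" and [measurable]: "f \<in> borel_measurable M" and le: "AE x in M. \<bar>f x\<bar> \<le> \<bar>g x\<bar>"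
  shows "f \<in> L2 M"
proof -
  have "integrable M (\<lambda>x. (f x)\<^sup>2)"
    by (rule Bochner_Integration.integrable_bound[OF L2_integrable_sq[OF g]])
       (use le in \<open>auto simp: abs_le_square_iff\<close>)
  then show ?thesis by (simp add: L2_def)
qed

lemma L2_add:
  assumes "f \<in> L2 M" "g \<in> L2 M"
  shows "(\<lambda>x. f x + g x) \<in> L2 M"
  using assms L2_integrable_mult[OF assms]
  by (auto simp: L2_def power2_sum mult.assoc intro!: Bochner_Integration.integrable_add)

lemma L2_cmult: "f \<in> L2 M \<Longrightarrow> (\<lambda>x. c * f x) \<in> L2 M"
  by (auto simp: L2_def power_mult_distrib)

lemma L2_diff:
  assumes "f \<in> L2 M" "g \<in> L2 M"
  shows "(\<lambda>x. f x - g x) \<in> L2 M"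
  using L2_add[OF assms(1) L2_cmult[OF assms(2), of "-1"]] by simp

lemma L2_abs: "f \<in> L2 M \<Longrightarrow> (\<lambda>x. \<bar>f x\<bar>) \<in> L2 M"
  by (auto simp: L2_def)

lemma L2_indicator:
  assumes "A \<in> sets M" "emeasure M A < \<infinity>"
  shows "indicator A \<in> L2 M"
  using assms integrable_real_indicator[OF assms] borel_measurable_indicator[OF assms(1), where 'b = real]
  by (simp add: L2_def power2_eq_square flip: indicator_inter_arith)

lemma L2_iff_nn_integral:
  assumes [measurable]: "f \<in> borel_measurable M"
  shows "f \<in> L2 M \<longleftrightarrow> (\<integral>\<^sup>+ x. ennreal ((f x)\<^sup>2) \<partial>M) < \<infinity>"
  by (auto simp: L2_def integrable_iff_bounded)

lemma L2_nn_integral: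
  assumes "f \<in> L2 M"
  shows "(\<integral>\<^sup>+ x. ennreal ((f x)\<^sup>2) \<partial>M) = ennreal (\<integral> x. (f x)\<^sup>2 \<partial>M)"
  by (rule nn_integral_eq_integral[OF L2_integrable_sq[OF assms]]) simp

lemma L2_Cauchy_Schwarz:
  assumes f: "f \<in> L2 M" and g: "g \<in> L2 M"
  shows "(\<integral> x. \<bar>f x\<bar> * \<bar>g x\<bar> \<partial>M)\<^sup>2 \<le> (\<integral> x. (f x)\<^sup>2 \<partial>M) * (\<integral> x. (g x)\<^sup>2 \<partial>M)"
proof -
  note [measurable] = f g
  have "(\<integral>\<^sup>+ x. ennreal \<bar>f x\<bar> * ennreal \<bar>g x\<bar> \<partial>M)\<^sup>2
      \<le> (\<integral>\<^sup>+ x. (ennreal \<bar>f x\<bar>)\<^sup>2 \<partial>M) * (\<integral>\<^sup>+ x. (ennreal \<bar>g x\<bar>)\<^sup>2 \<partial>M)"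
    by (rule Cauchy_Schwarz_nn_integral) measurable
  moreover have "(\<integral>\<^sup>+ x. ennreal \<bar>f x\<bar> * ennreal \<bar>g x\<bar> \<partial>M)
      = ennreal (\<integral> x. \<bar>f x\<bar> * \<bar>g x\<bar> \<partial>M)"
    using nn_integral_eq_integral[OF L2_integrable_mult[OF L2_abs[OF f] L2_abs[OF g]]]
    by (simp add: ennreal_mult)
  moreover have "0 \<le> (\<integral> x. \<bar>f x\<bar> * \<bar>g x\<bar> \<partial>M)" "0 \<le> (\<integral> x. (f x)\<^sup>2 \<partial>M)" "0 \<le> (\<integral> x. (g x)\<^sup>2 \<partial>M)"
    by simp_all
  ultimately show ?thesis
    using f g by (simp add: ennreal_power L2_nn_integral flip: ennreal_mult)
qed

text \<open>Clipping \<open>q k\<close> to the range between \<open>- \<bar>p x\<bar>\<close> and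
  \<open>\<bar>p x\<bar>\<close> gives functions \<open>t k\<close> to which dominated convergence
  applies. What is cut off is at most \<open>\<bar>P k x - p x\<bar>\<close>, which tends to 0 in
  mean square, so Cauchy-Schwarz removes it.\<close>

lemma L2_dominated_weak_limit:
  assumes h: "h \<in> L2 M" and p: "p \<in> L2 M" and P: "\<And>k. P k \<in> L2 M"
    and lim: "(\<lambda>k. \<integral> x. (P k x - p x)\<^sup>2 \<partial>M) \<longlonglongrightarrow> 0"
    and q: "\<And>k. q k \<in> borel_measurable M" "\<And>k x. \<bar>q k x\<bar> \<le> \<bar>P k x\<bar>"
    and ae: "AE x in M. (\<lambda>k. q k x) \<longlonglongrightarrow> p x"
  shows "(\<lambda>k. \<integral> x. h x * q k x \<partial>M) \<longlonglongrightarrow> (\<integral> x. h x * p x \<partial>M)"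
proof -
  note [measurable] = h p P q(1)
  define t where "t k x = max (- \<bar>p x\<bar>) (min \<bar>p x\<bar> (q k x))" for k x
  have [measurable]: "t k \<in> borel_measurable M" for k
    unfolding t_def by measurable
  have q_L2: "q k \<in> L2 M" for k
    by (rule L2_mono[OF P[of k]]) (use q in auto)
  have t_L2: "t k \<in> L2 M" for k
    by (rule L2_mono[OF p]) (auto simp: t_def)
  have "(\<lambda>k. \<integral> x. h x * t k x \<partial>M) \<longlonglongrightarrow> (\<integral> x. h x * p x \<partial>M)"
  proof (rule integral_dominated_convergence)
    show "integrable M (\<lambda>x. \<bar>h x\<bar> * \<bar>p x\<bar>)"
      using L2_integrable_mult[OF L2_abs[OF h] L2_abs[OF p]] .
    show "AE x in M. (\<lambda>k. h x * t k x) \<longlonglongrightarrow> h x * p x"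
      using ae
    proof eventually_elim
      case (elim x)
      have "(\<lambda>k. t k x) \<longlonglongrightarrow> max (- \<bar>p x\<bar>) (min \<bar>p x\<bar> (p x))"
        unfolding t_def by (intro tendsto_intros elim)
      then have "(\<lambda>k. t k x) \<longlonglongrightarrow> p x" by (simp add: max_def min_def split: if_splits)
      then show ?case by (rule tendsto_mult_left)
    qed
    show "AE x in M. norm (h x * t k x) \<le> \<bar>h x\<bar> * \<bar>p x\<bar>" for k
      by (auto simp: t_def abs_mult intro!: mult_left_mono)
  qed measurable
  moreover have "(\<lambda>k. \<integral> x. h x * (q k x - t k x) \<partial>M) \<longlonglongrightarrow> 0"
  proof (rule tendsto_0_le[where K = 1])
    let ?e = "\<lambda>k. sqrt ((\<integral> x. (h x)\<^sup>2 \<partial>M) * (\<integral> x. (P k x - p x)\<^sup>2 \<partial>M))"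
    have "?e \<longlonglongrightarrow> sqrt ((\<integral> x. (h x)\<^sup>2 \<partial>M) * 0)"
      by (intro tendsto_intros lim)
    then show "?e \<longlonglongrightarrow> 0" by simp
    show "\<forall>\<^sub>F k in sequentially. norm (\<integral> x. h x * (q k x - t k x) \<partial>M) \<le> norm (?e k) * 1"
    proof (rule always_eventually, rule allI)
      fix k
      have d: "(\<lambda>x. P k x - p x) \<in> L2 M" by (rule L2_diff[OF P p])
      have "norm (\<integral> x. h x * (q k x - t k x) \<partial>M) \<le> (\<integral> x. \<bar>h x\<bar> * \<bar>P k x - p x\<bar> \<partial>M)"
      proof (rule order_trans[OF integral_norm_bound integral_mono])
        show "integrable M (\<lambda>x. norm (h x * (q k x - t k x)))"
          by (rule integrable_norm[OF L2_integrable_mult[OF h L2_diff[OF q_L2 t_L2]]])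
        show "integrable M (\<lambda>x. \<bar>h x\<bar> * \<bar>P k x - p x\<bar>)"
          by (rule L2_integrable_mult[OF L2_abs[OF h] L2_abs[OF d]])
        \<comment> \<open>Clipping acts only where \<open>\<bar>q k x\<bar>\<close> exceeds
          \<open>\<bar>p x\<bar>\<close>; the loss there is
          \<open>\<bar>q k x\<bar> - \<bar>p x\<bar>\<close>, at most
          \<open>\<bar>P k x\<bar> - \<bar>p x\<bar>\<close>.\<close>
        show "norm (h x * (q k x - t k x)) \<le> \<bar>h x\<bar> * \<bar>P k x - p x\<bar>" for x
          using q(2)[of k x] by (auto simp: abs_mult t_def intro!: mult_left_mono)
      qed
      also have "\<dots> \<le> ?e k"
        by (rule real_le_rsqrt[OF L2_Cauchy_Schwarz[OF h d]])
      finally show "norm (\<integral> x. h x * (q k x - t k x) \<partial>M) \<le> norm (?e k) * 1"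
        by simp
    qed
  qed
  ultimately have "(\<lambda>k. (\<integral> x. h x * t k x \<partial>M) + (\<integral> x. h x * (q k x - t k x) \<partial>M))
      \<longlonglongrightarrow> (\<integral> x. h x * p x \<partial>M) + 0"
    by (rule tendsto_add)
  moreover have "(\<integral> x. h x * t k x \<partial>M) + (\<integral> x. h x * (q k x - t k x) \<partial>M)
      = (\<integral> x. h x * q k x \<partial>M)" for k
    using L2_integrable_mult[OF h q_L2, of k] L2_integrable_mult[OF h t_L2, of k]
    by (simp add: right_diff_distrib)
  ultimately show ?thesis by simp
qed

section \<open>The Gagliardo form as an inner product of difference quotients\<close>

abbreviation pair_lebesgue :: "('a::euclidean_space \<times> 'a) measure" where
  "pair_lebesgue \<equiv> lebesgue \<Otimes>\<^sub>M lebesgue"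

text \<open>The exponent is half that of the Gagliardo kernel, so that \<open>frac_lap\<close>
  becomes half an inner product of two such quotients.\<close>

definition quot :: "real \<Rightarrow> ('a::euclidean_space \<Rightarrow> real) \<Rightarrow> 'a \<times> 'a \<Rightarrow> real" where
  "quot s u z = (u (fst z) - u (snd z)) / norm (fst z - snd z) powr ((real DIM('a) + 2 * s) / 2)"

lemma measurable_ident_lebesgue_borel[measurable]: "(\<lambda>x. x) \<in> lebesgue \<rightarrow>\<^sub>M (borel :: 'a::euclidean_space measure)"
  by (simp add: measurable_completion)

lemma sets_lebesgue_sublevel:
  fixes w :: "'a::euclidean_space \<Rightarrow> real"
  assumes [measurable]: "w \<in> borel_measurable lebesgue"
  shows "{x. 0 < c - w x} \<in> sets lebesgue" "{x. 0 \<le> c - w x} \<in> sets lebesgue"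
proof -
  have "{x \<in> space lebesgue. 0 < c - w x} \<in> sets lebesgue" "{x \<in> space lebesgue. 0 \<le> c - w x} \<in> sets lebesgue"
    by measurable
  then show "{x. 0 < c - w x} \<in> sets lebesgue" "{x. 0 \<le> c - w x} \<in> sets lebesgue"
    by simp_all
qed

lemma measurable_fst_pair_lebesgue[measurable]:
    "fst \<in> pair_lebesgue \<rightarrow>\<^sub>M (borel :: 'a::euclidean_space measure)"
  and measurable_snd_pair_lebesgue[measurable]:
    "snd \<in> pair_lebesgue \<rightarrow>\<^sub>M (borel :: 'a::euclidean_space measure)"
  using measurable_compose[OF measurable_fst measurable_ident_lebesgue_borel]
    measurable_compose[OF measurable_snd measurable_ident_lebesgue_borel] by (simp_all add: o_def)

lemma quot_measurable[measurable]:
  fixes u :: "'a::euclidean_space \<Rightarrow> real"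
  assumes u: "u \<in> borel_measurable lebesgue"
  shows "quot s u \<in> borel_measurable pair_lebesgue"
proof -
  have [measurable]: "(\<lambda>z. u (fst z)) \<in> borel_measurable pair_lebesgue"
      "(\<lambda>z. u (snd z)) \<in> borel_measurable pair_lebesgue"
    using measurable_compose[OF measurable_fst u] measurable_compose[OF measurable_snd u] by auto
  show ?thesis unfolding quot_def[abs_def] by measurable
qed

lemma quot_mult:
  fixes u v :: "'a::euclidean_space \<Rightarrow> real"
  shows "quot s u z * quot s v z = (u (fst z) - u (snd z)) * (v (fst z) - v (snd z))
           / norm (fst z - snd z) powr (real DIM('a) + 2 * s)"
  by (simp add: quot_def flip: powr_add)

lemma gagliardo_sq_quot: "gagliardo_sq s u = (\<integral>\<^sup>+ z. ennreal ((quot s u z)\<^sup>2) \<partial>pair_lebesgue)"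
  by (simp add: gagliardo_sq_def power2_eq_square quot_mult)

lemma frac_lap_quot: "frac_lap s u v = 1 / 2 * (\<integral> z. quot s u z * quot s v z \<partial>pair_lebesgue)"
  by (simp add: frac_lap_def quot_mult)

lemma quot_diff: "quot s (\<lambda>x. u x - v x) z = quot s u z - quot s v z"
  and quot_cmult: "quot s (\<lambda>x. c * u x) z = c * quot s u z"
  and quot_const_minus: "quot s (\<lambda>x. c - u x) z = - quot s u z"
  by (simp_all add: quot_def algebra_simps add_divide_distrib diff_divide_distrib)

lemma quot_mono:
  assumes "\<bar>u (fst z) - u (snd z)\<bar> \<le> \<bar>v (fst z) - v (snd z)\<bar>"
  shows "\<bar>quot s u z\<bar> \<le> \<bar>quot s v z\<bar>"
  using assms by (simp add: quot_def divide_right_mono)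

text \<open>Membership splits into square integrability on two measure spaces, so closure properties
  of \<open>Hs\<close> are inherited from \<open>L2\<close>.\<close>

lemma Hs_iff_L2: "v \<in> Hs s \<longleftrightarrow> v \<in> L2 lebesgue \<and> quot s v \<in> L2 pair_lebesgue"
proof (cases "v \<in> borel_measurable lebesgue")
  case True
  then show ?thesis
    using L2_iff_nn_integral[OF quot_measurable[OF True, of s]]
    by (simp add: Hs_def gagliardo_sq_quot) (simp add: L2_def)
qed (simp add: Hs_def L2_def)

lemma Hs_L2: "v \<in> Hs s \<Longrightarrow> v \<in> L2 lebesgue"
  and Hs_quot_L2: "v \<in> Hs s \<Longrightarrow> quot s v \<in> L2 pair_lebesgue"
  by (simp_all add: Hs_iff_L2)

lemma Hs_diff: "u \<in> Hs s \<Longrightarrow> v \<in> Hs s \<Longrightarrow> (\<lambda>x. u x - v x) \<in> Hs s"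
  and Hs_cmult: "u \<in> Hs s \<Longrightarrow> (\<lambda>x. c * u x) \<in> Hs s"
  unfolding Hs_iff_L2
  by (auto simp: quot_diff[abs_def] quot_cmult[abs_def] L2_diff L2_cmult)

lemma Hs_contraction:
  assumes v: "v \<in> Hs s" and u: "u \<in> borel_measurable lebesgue"
    and "\<And>x. \<bar>u x\<bar> \<le> \<bar>v x\<bar>" "\<And>x y. \<bar>u x - u y\<bar> \<le> \<bar>v x - v y\<bar>"
  shows "u \<in> Hs s"
  unfolding Hs_iff_L2
  using L2_mono[OF Hs_L2[OF v] u] L2_mono[OF Hs_quot_L2[OF v] quot_measurable[OF u]]
  by (auto simp: assms quot_mono)

lemma Hs0_Hs: "v \<in> Hs0 s D \<Longrightarrow> v \<in> Hs s"
  by (simp add: Hs0_def)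

lemma Hs0_diff: "u \<in> Hs0 s D \<Longrightarrow> v \<in> Hs0 s D \<Longrightarrow> (\<lambda>x. u x - v x) \<in> Hs0 s D"
  and Hs0_cmult: "u \<in> Hs0 s D \<Longrightarrow> (\<lambda>x. c * u x) \<in> Hs0 s D"
  by (auto simp: Hs0_def Hs_diff Hs_cmult)

text \<open>Truncation at 0 is a 1-Lipschitz map fixing 0, so it increases neither values nor
  increments in modulus.\<close>

lemma Hs0_positive_part:
  assumes "u \<in> Hs0 s D"
  shows "(\<lambda>x. max (u x) 0) \<in> Hs0 s D"
proof -
  have u: "u \<in> Hs s" using assms by (simp add: Hs0_def)
  note [measurable] = Hs_L2[OF u]
  have "(\<lambda>x. max (u x) 0) \<in> Hs s"
    by (rule Hs_contraction[OF u]) (auto simp: max_def)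
  then show ?thesis using assms by (auto simp: Hs0_def)
qed

section \<open>Algebra and positivity of the fractional form\<close>

lemma frac_lap_diff_left:
  assumes "u \<in> Hs s" "v \<in> Hs s" "w \<in> Hs s"
  shows "frac_lap s (\<lambda>x. u x - v x) w = frac_lap s u w - frac_lap s v w"
  using L2_integrable_mult[OF Hs_quot_L2 Hs_quot_L2, OF assms(1,3)]
    L2_integrable_mult[OF Hs_quot_L2 Hs_quot_L2, OF assms(2,3)]
  by (simp add: frac_lap_quot quot_diff left_diff_distrib)

lemma frac_lap_const_minus: "frac_lap s (\<lambda>x. c - u x) v = - frac_lap s u v"
  by (simp add: frac_lap_quot quot_const_minus)

lemma gagliardo_sq_const_minus: "gagliardo_sq s (\<lambda>x. c - u x) = gagliardo_sq s u"
  by (simp add: gagliardo_sq_quot quot_const_minus)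

lemma gagliardo_sq_eq_frac_lap:
  assumes "u \<in> Hs s"
  shows "gagliardo_sq s u = ennreal (2 * frac_lap s u u)"
  using L2_nn_integral[OF Hs_quot_L2[OF assms]]
  by (simp add: gagliardo_sq_quot frac_lap_quot power2_eq_square)

lemma frac_lap_self_nonneg: "0 \<le> frac_lap s u u"
  by (simp add: frac_lap_quot flip: power2_eq_square)

lemma frac_lap_diff_self:
  assumes "u \<in> Hs s" "w \<in> Hs s"
  shows "frac_lap s (\<lambda>x. w x - u x) (\<lambda>x. w x - u x)
       = frac_lap s w w - 2 * frac_lap s u w + frac_lap s u u"
proof -
  have "(\<lambda>z. quot s (\<lambda>x. w x - u x) z * quot s (\<lambda>x. w x - u x) z)
      = (\<lambda>z. quot s w z * quot s w z - 2 * (quot s u z * quot s w z) + quot s u z * quot s u z)"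
    by (auto simp: quot_diff algebra_simps)
  then show ?thesis
    using L2_integrable_mult[OF Hs_quot_L2 Hs_quot_L2, OF assms(2,2)]
      L2_integrable_mult[OF Hs_quot_L2 Hs_quot_L2, OF assms(1,2)]
      L2_integrable_mult[OF Hs_quot_L2 Hs_quot_L2, OF assms(1,1)]
    by (simp add: frac_lap_quot)
qed

text \<open>The right side exceeds the left by minus the form of the negative and positive parts of
  \<open>g\<close>. Since \<open>max a 0\<close> is nondecreasing and \<open>max (- a) 0\<close>
  nonincreasing in \<open>a\<close>, the product of their increments is never positive, so the
  excess is nonnegative pair by pair.\<close>

lemma frac_lap_positive_part_le:
  assumes g: "g \<in> Hs s" and gp: "(\<lambda>x. max (g x) 0) \<in> Hs s"
  shows "frac_lap s (\<lambda>x. max (g x) 0) (\<lambda>x. max (g x) 0) \<le> frac_lap s g (\<lambda>x. max (g x) 0)"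
proof -
  have "(\<integral> z. quot s (\<lambda>x. max (g x) 0) z * quot s (\<lambda>x. max (g x) 0) z \<partial>pair_lebesgue)
      \<le> (\<integral> z. quot s g z * quot s (\<lambda>x. max (g x) 0) z \<partial>pair_lebesgue)"
  proof (rule integral_mono)
    fix z :: "'a \<times> 'a"
    have "(max a 0 - max b 0) * (max a 0 - max b 0) \<le> (a - b) * (max a 0 - max b 0)" for a b :: real
    proof -
      have "0 \<le> (max (- b) 0 - max (- a) 0) * (max a 0 - max b 0)"
        by (cases "a \<le> b") (auto intro!: mult_nonneg_nonneg mult_nonpos_nonpos)
      moreover have "a - b - (max a 0 - max b 0) = max (- b) 0 - max (- a) 0" by auto
      ultimately show ?thesis by (metis diff_ge_0_iff_ge left_diff_distrib)
    qed
    then show "quot s (\<lambda>x. max (g x) 0) z * quot s (\<lambda>x. max (g x) 0) z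
        \<le> quot s g z * quot s (\<lambda>x. max (g x) 0) z"
      by (simp add: quot_mult divide_right_mono)
  qed (intro L2_integrable_mult Hs_quot_L2 g gp)+
  then show ?thesis by (simp add: frac_lap_quot)
qed

lemma sigma_finite_lebesgue: "sigma_finite_measure (lebesgue :: 'a::euclidean_space measure)"
proof -
  obtain A :: "'a set set" where A: "countable A" "A \<subseteq> sets lborel" "\<Union>A = space lborel" "\<forall>a\<in>A. emeasure lborel a \<noteq> \<infinity>"
    using lborel.sigma_finite_countable by blast
  show ?thesis
    by standard (use A in \<open>intro exI[of _ A], force simp: subset_eq\<close>)
qed

interpretation pair_lebesgue: pair_sigma_finite
    "lebesgue :: 'a::euclidean_space measure" "lebesgue :: 'a measure"
  by (simp add: pair_sigma_finite_def sigma_finite_lebesgue)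

lemma AE_lebesgue_neq: "AE x in lebesgue. x \<noteq> (c :: 'a::euclidean_space)"
  by (rule AE_completion) (rule AE_lborel_singleton)

text \<open>A vanishing form makes the difference quotients zero for almost all pairs. Fixing one
  generic point \<open>x\<close> shows that \<open>g\<close> is almost everywhere the constant
  \<open>g x\<close>; the whole space has infinite measure, so 0 is the only square integrable
  constant.\<close>

lemma Hs_AE_zero_if_frac_lap_nonpos:
  fixes g :: "'a::euclidean_space \<Rightarrow> real"
  assumes g: "g \<in> Hs s" and z: "frac_lap s g g \<le> 0"
  shows "AE x in lebesgue. g x = 0"
proof -
  note [measurable] = Hs_L2[OF g]
  have z0: "frac_lap s g g = 0"
    by (rule antisym[OF z frac_lap_self_nonneg])
  have "(\<integral> z. (quot s g z)\<^sup>2 \<partial>pair_lebesgue) = 0"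
    using z0 by (simp add: frac_lap_quot power2_eq_square)
  then have "AE z in pair_lebesgue. (quot s g z)\<^sup>2 = 0"
    by (subst (asm) integral_nonneg_eq_0_iff_AE[OF L2_integrable_sq[OF Hs_quot_L2[OF g]]]) auto
  then have ae2: "AE x in lebesgue. AE y in lebesgue. (quot s g (x, y))\<^sup>2 = 0"
    by (rule pair_lebesgue.AE_pair)
  have "\<exists>x. AE y in lebesgue. (quot s g (x, y))\<^sup>2 = 0"
  proof (rule ccontr)
    assume "\<nexists>x. AE y in lebesgue. (quot s g (x, y))\<^sup>2 = 0"
    with ae2 have "AE x::'a in lebesgue. False" by simp
    then have "AE x::'a in lborel. False" by (simp only: AE_completion_iff)
    then show False by (simp add: AE_iff_null null_sets_def)
  qed
  then obtain x where x: "AE y in lebesgue. (quot s g (x, y))\<^sup>2 = 0" ..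
  have ae: "AE y in lebesgue. g y = g x"
    using x AE_lebesgue_neq[of x]
    by eventually_elim (auto simp: quot_def)
  have "integrable lebesgue (\<lambda>y::'a. (g x)\<^sup>2)"
  proof (rule integrable_cong_AE_imp[OF L2_integrable_sq[OF Hs_L2[OF g]]])
    show "AE y in lebesgue. (g y)\<^sup>2 = (g x)\<^sup>2" using ae by eventually_elim simp
  qed simp
  then have "ennreal ((g x)\<^sup>2) * emeasure lebesgue (UNIV :: 'a set) < \<infinity>"
    unfolding integrable_iff_bounded by simp
  then have "ennreal ((g x)\<^sup>2) * \<infinity> < \<infinity>"
    by simp
  then have "g x = 0"
    by (simp add: ennreal_mult_less_top)
  with ae show ?thesis by simp
qed

section \<open>Test functions\<close>

lemma nonzero_dyadic_radius:
  fixes r :: real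
  assumes "0 < r"
  obtains (small) m where "(1/2) ^ Suc m \<le> r" "r \<le> (1/2) ^ m"
    | (large) m where "2 ^ m \<le> r" "r \<le> 2 ^ Suc m"
proof (cases "r \<le> 1")
  case True
  obtain n where "(1/2) ^ n < r"
    using real_arch_pow_inv[OF assms, of "1/2"] by auto
  \<comment> \<open>\<open>Suc m\<close> is the first exponent whose power drops below
    \<open>r\<close>, which traps \<open>r\<close> between consecutive dyadic numbers. The lower end
    will bound the kernel, the upper end the radius of a ball containing the point.\<close>
  then obtain m where "\<not> (1/2) ^ m < r" "(1/2) ^ Suc m < r"
    using ex_least_nat_less[of "\<lambda>m. (1/2) ^ m < r" n] True by auto
  then show ?thesis by (intro small[of m]) auto
next
  case False
  obtain n where "r < 2 ^ n"
    using real_arch_pow[of 2 r] by auto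
  then obtain m where "\<not> r < 2 ^ m" "r < 2 ^ Suc m"
    using ex_least_nat_less[of "\<lambda>m. r < 2 ^ m" n] False by auto
  then show ?thesis by (intro large[of m]) auto
qed

lemma suminf_geometric_finite:
  fixes c q :: real
  assumes "0 \<le> c" "0 \<le> q" "q < 1"
  shows "(\<Sum>m. ennreal (c * q ^ m)) < \<infinity>"
proof -
  have "(\<Sum>m. ennreal (c * q ^ m)) = ennreal (\<Sum>m. c * q ^ m)"
    by (rule suminf_ennreal2) (use assms in \<open>auto intro!: summable_mult summable_geometric\<close>)
  then show ?thesis by simp
qed

lemma ennreal_term_le_suminf: "f m \<le> (\<Sum>m. f m)" for f :: "nat \<Rightarrow> ennreal"
  using sum_le_suminf[of f "{m}"] by simp

text \<open>The singularity and the tail of the kernel are summed over dyadic balls around \<open>y\<close>: the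
  Lipschitz bound beats the singularity because \<open>s < 1\<close>, boundedness suffices in the tail
  because \<open>0 < s\<close>.\<close>

lemma nn_integral_kernel_bounded:
  fixes \<eta> :: "'a::euclidean_space \<Rightarrow> real"
  assumes s: "0 < s" "s < 1"
    and bdd: "\<And>x. \<bar>\<eta> x\<bar> \<le> B" and lip: "\<And>x y. \<bar>\<eta> x - \<eta> y\<bar> \<le> L * norm (x - y)"
  shows "\<exists>C<\<infinity>. \<forall>y. (\<integral>\<^sup>+ x. ennreal ((quot s \<eta> (x, y))\<^sup>2) \<partial>lebesgue) \<le> C"
proof -
  define n where "n = DIM('a)"
  define p where "p = real n + 2 * s"
  have p: "0 < p" using s by (simp add: p_def)
  \<comment> \<open>On the shell from radius \<open>(1/2) ^ Suc m\<close> to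
    \<open>(1/2) ^ m\<close> the squared quotient is at most \<open>a m\<close>: the Lipschitz bound
    is taken at the outer radius, the kernel at the inner one. Likewise \<open>b m\<close> bounds it
    at distances from \<open>2 ^ m\<close> to \<open>2 ^ Suc m\<close>, with oscillation
    \<open>2 * B\<close>.\<close>
  define a where "a m = (L * (1/2) ^ m)\<^sup>2 / ((1/2) ^ Suc m) powr p" for m :: nat
  define b where "b m = (2 * B)\<^sup>2 / (2 ^ m) powr p" for m :: nat
  define \<omega> where "\<omega> = unit_ball_vol (real n)"
  have \<omega>: "0 \<le> \<omega>" by (simp add: \<omega>_def)
  define C where "C = (\<Sum>m. ennreal (a m * (\<omega> * ((1/2) ^ m) ^ n))) + (\<Sum>m. ennreal (b m * (\<omega> * (2 ^ Suc m) ^ n)))"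
  have a0: "0 \<le> a m" and b0: "0 \<le> b m" for m by (simp_all add: a_def b_def)
  have two: "(2::real) ^ m = 2 powr real m" "(1/2::real) ^ m = 2 powr (- real m)" for m
    by (simp_all add: powr_realpow powr_minus power_one_over field_simps)
  \<comment> \<open>Weighted by ball volumes, the bounds become geometric: the ratio is
    \<open>2 powr (2 * s - 2)\<close> near the singularity and \<open>2 powr (- 2 * s)\<close> in
    the tail.\<close>
  have A: "a m * (\<omega> * ((1/2) ^ m) ^ n) = (L\<^sup>2 * \<omega> * 2 powr p) * (2 powr (2 * s - 2)) ^ m" for m
  proof -
    have "a m * (\<omega> * ((1/2) ^ m) ^ n)
        = L\<^sup>2 * \<omega> * (((1/2) ^ m)\<^sup>2 * ((1/2) ^ m) ^ n / ((1/2) ^ Suc m) powr p)"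
      by (simp add: a_def power_mult_distrib)
    also have "((1/2) ^ m)\<^sup>2 * ((1/2) ^ m) ^ n / ((1/2) ^ Suc m) powr p
        = 2 powr (- 2 * m - m * n + (m + 1) * p)"
      unfolding two powr_powr powr_realpow[symmetric, OF powr_gt_zero[THEN iffD2, OF zero_neq_numeral[symmetric]]]
      by (simp add: algebra_simps flip: powr_add powr_diff)
    also have "\<dots> = 2 powr p * (2 powr (2 * s - 2)) ^ m"
      by (simp add: powr_powr p_def algebra_simps flip: powr_add powr_realpow)
    finally show ?thesis by simp
  qed
  have B: "b m * (\<omega> * (2 ^ Suc m) ^ n) = ((2 * B)\<^sup>2 * \<omega> * 2 powr n) * (2 powr (- 2 * s)) ^ m" for m
  proof -
    have "b m * (\<omega> * (2 ^ Suc m) ^ n) = (2 * B)\<^sup>2 * \<omega> * ((2 ^ Suc m) ^ n / (2 ^ m) powr p)"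
      by (simp add: b_def)
    also have "(2 ^ Suc m) ^ n / (2 ^ m) powr p = 2 powr ((m + 1) * n - m * p)"
      unfolding two powr_powr powr_realpow[symmetric, OF powr_gt_zero[THEN iffD2, OF zero_neq_numeral[symmetric]]]
      by (simp add: algebra_simps flip: powr_add powr_diff)
    also have "\<dots> = 2 powr n * (2 powr (- 2 * s)) ^ m"
      by (simp add: powr_powr p_def algebra_simps flip: powr_add powr_realpow)
    finally show ?thesis by simp
  qed
  have "C < \<infinity>"
    unfolding C_def A B using s \<omega>
    by (auto intro!: suminf_geometric_finite[unfolded infinity_ennreal_def] simp: powr_less_one)
  moreover have "(\<integral>\<^sup>+ x. ennreal ((quot s \<eta> (x, y))\<^sup>2) \<partial>lebesgue) \<le> C" for y
  proof -
    have [measurable]: "cball y r \<in> sets lebesgue" for r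
      by simp
    have "(\<integral>\<^sup>+ x. ennreal ((quot s \<eta> (x, y))\<^sup>2) \<partial>lebesgue)
       \<le> (\<integral>\<^sup>+ x. (\<Sum>m. ennreal (a m) * indicator (cball y ((1/2) ^ m)) x)
               + (\<Sum>m. ennreal (b m) * indicator (cball y (2 ^ Suc m)) x) \<partial>lebesgue)"
    proof (rule nn_integral_mono)
      fix x
      define r where "r = norm (x - y)"
      have q: "(quot s \<eta> (x, y))\<^sup>2 = (\<eta> x - \<eta> y)\<^sup>2 / r powr p"
        by (simp add: power2_eq_square quot_mult r_def p_def n_def)
      show "ennreal ((quot s \<eta> (x, y))\<^sup>2) \<le> (\<Sum>m. ennreal (a m) * indicator (cball y ((1/2) ^ m)) x)
               + (\<Sum>m. ennreal (b m) * indicator (cball y (2 ^ Suc m)) x)"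
      proof (cases "x = y")
        case True
        then show ?thesis by (simp add: quot_def)
      next
        case False
        then have "0 < r" by (simp add: r_def)
        then show ?thesis
        proof (cases rule: nonzero_dyadic_radius)
          case (small m)
          have "\<bar>\<eta> x - \<eta> y\<bar> \<le> \<bar>L\<bar> * r"
            using lip[of x y] mult_right_mono[OF abs_ge_self[of L], of r] \<open>0 < r\<close>
            unfolding r_def by linarith
          also have "\<dots> \<le> \<bar>L\<bar> * (1/2) ^ m" using small by (intro mult_left_mono) auto
          finally have "(\<eta> x - \<eta> y)\<^sup>2 \<le> (L * (1/2) ^ m)\<^sup>2"
            by (simp add: abs_mult flip: abs_le_square_iff)
          moreover have "((1/2) ^ Suc m) powr p \<le> r powr p"
            using small p by (intro powr_mono2) auto
          ultimately have "(quot s \<eta> (x, y))\<^sup>2 \<le> a m"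
            unfolding q a_def by (intro frac_le) auto
          then have "ennreal ((quot s \<eta> (x, y))\<^sup>2) \<le> ennreal (a m) * indicator (cball y ((1/2) ^ m)) x"
            using small by (simp add: ennreal_leI r_def dist_norm norm_minus_commute)
          also have "\<dots> \<le> (\<Sum>m. ennreal (a m) * indicator (cball y ((1/2) ^ m)) x)"
            by (rule ennreal_term_le_suminf)
          finally show ?thesis by (rule order_trans) simp
        next
          case (large m)
          have "\<bar>\<eta> x - \<eta> y\<bar> \<le> 2 * B"
            using bdd[of x] bdd[of y] by linarith
          then have "(\<eta> x - \<eta> y)\<^sup>2 \<le> (2 * B)\<^sup>2"
            using power_mono[of "\<bar>\<eta> x - \<eta> y\<bar>" "2 * B" 2] by (simp only: power2_abs abs_ge_zero)
          moreover have "(2 ^ m) powr p \<le> r powr p"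
            using large p by (intro powr_mono2) auto
          ultimately have "(quot s \<eta> (x, y))\<^sup>2 \<le> b m"
            unfolding q b_def by (intro frac_le) auto
          then have "ennreal ((quot s \<eta> (x, y))\<^sup>2) \<le> ennreal (b m) * indicator (cball y (2 ^ Suc m)) x"
            using large by (simp add: ennreal_leI r_def dist_norm norm_minus_commute)
          also have "\<dots> \<le> (\<Sum>m. ennreal (b m) * indicator (cball y (2 ^ Suc m)) x)"
            by (rule ennreal_term_le_suminf)
          finally show ?thesis by (rule order_trans) simp
        qed
      qed
    qed
    also have "\<dots> = (\<Sum>m. \<integral>\<^sup>+ x. ennreal (a m) * indicator (cball y ((1/2) ^ m)) x \<partial>lebesgue)
               + (\<Sum>m. \<integral>\<^sup>+ x. ennreal (b m) * indicator (cball y (2 ^ Suc m)) x \<partial>lebesgue)"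
      by (simp add: nn_integral_add nn_integral_suminf del: power_Suc)
    also have "\<dots> = C"
      unfolding C_def \<omega>_def n_def using a0 b0
      by (simp add: nn_integral_cmult_indicator emeasure_cball ennreal_mult'
          del: power_Suc)
    finally show ?thesis by simp
  qed
  ultimately show ?thesis by blast
qed

lemma quot_swap_sq: "(quot s u (x, y))\<^sup>2 = (quot s u (y, x))\<^sup>2"
  by (simp add: quot_def norm_minus_commute power2_commute power_divide)

text \<open>Integrate first in the variable on which \<open>g\<close> does not depend:
  \<open>nn_integral_kernel_bounded\<close> is uniform in the other one, and the square integral of
  \<open>g\<close> remains. Symmetry of the squared quotient lets one bound serve both
  orders.\<close>

lemma L2_mult_quot:
  fixes g \<eta> :: "'a::euclidean_space \<Rightarrow> real"
  assumes s: "0 < s" "s < 1"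
    and bdd: "\<And>x. \<bar>\<eta> x\<bar> \<le> B" and lip: "\<And>x y. \<bar>\<eta> x - \<eta> y\<bar> \<le> L * norm (x - y)"
    and \<eta>[measurable]: "\<eta> \<in> borel_measurable lebesgue" and g: "g \<in> L2 lebesgue"
  shows "(\<lambda>z. g (snd z) * quot s \<eta> z) \<in> L2 pair_lebesgue"
    and "(\<lambda>z. g (fst z) * quot s \<eta> z) \<in> L2 pair_lebesgue"
proof -
  obtain C where C: "C < \<infinity>" "\<And>y. (\<integral>\<^sup>+ x. ennreal ((quot s \<eta> (x, y))\<^sup>2) \<partial>lebesgue) \<le> C"
    using nn_integral_kernel_bounded[OF s bdd lip] by blast
  have gm: "g \<in> borel_measurable lebesgue" by (rule L2_measurable[OF g])
  have q: "quot s \<eta> \<in> borel_measurable pair_lebesgue" by (rule quot_measurable[OF \<eta>])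
  note [measurable] = gm q measurable_compose[OF measurable_fst gm] measurable_compose[OF measurable_snd gm]
  have qx[measurable]: "(\<lambda>x. quot s \<eta> (x, y)) \<in> borel_measurable lebesgue" for y
    using measurable_compose[OF _ q, of "\<lambda>x. (x, y)"] by simp
  have qy[measurable]: "(\<lambda>y. quot s \<eta> (x, y)) \<in> borel_measurable lebesgue" for x
    using measurable_compose[OF _ q, of "\<lambda>y. (x, y)"] by simp
  have fin: "(\<integral>\<^sup>+ y. ennreal ((g y)\<^sup>2) * C \<partial>lebesgue) < \<infinity>"
    using C(1) by (simp add: nn_integral_multc L2_nn_integral[OF g] ennreal_mult_less_top)
  have "(\<integral>\<^sup>+ z. ennreal ((g (snd z) * quot s \<eta> z)\<^sup>2) \<partial>pair_lebesgue)
      = (\<integral>\<^sup>+ y. ennreal ((g y)\<^sup>2) * (\<integral>\<^sup>+ x. ennreal ((quot s \<eta> (x, y))\<^sup>2) \<partial>lebesgue) \<partial>lebesgue)"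
    by (subst pair_lebesgue.nn_integral_snd[symmetric])
       (simp_all add: power_mult_distrib ennreal_mult nn_integral_cmult)
  also have "\<dots> \<le> (\<integral>\<^sup>+ y. ennreal ((g y)\<^sup>2) * C \<partial>lebesgue)"
    by (intro nn_integral_mono mult_left_mono C) simp
  finally show "(\<lambda>z. g (snd z) * quot s \<eta> z) \<in> L2 pair_lebesgue"
    using fin by (subst L2_iff_nn_integral) auto
  have "(\<integral>\<^sup>+ z. ennreal ((g (fst z) * quot s \<eta> z)\<^sup>2) \<partial>pair_lebesgue)
      = (\<integral>\<^sup>+ x. ennreal ((g x)\<^sup>2) * (\<integral>\<^sup>+ y. ennreal ((quot s \<eta> (x, y))\<^sup>2) \<partial>lebesgue) \<partial>lebesgue)"
    by (subst sigma_finite_measure.nn_integral_fst[OF sigma_finite_lebesgue, symmetric])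
       (simp_all add: power_mult_distrib ennreal_mult nn_integral_cmult)
  also have "\<dots> \<le> (\<integral>\<^sup>+ y. ennreal ((g y)\<^sup>2) * C \<partial>lebesgue)"
    by (subst quot_swap_sq) (intro nn_integral_mono mult_left_mono C, simp)
  finally show "(\<lambda>z. g (fst z) * quot s \<eta> z) \<in> L2 pair_lebesgue"
    using fin by (subst L2_iff_nn_integral) auto
qed

section \<open>Test functions and their products in the fractional spaces\<close>

lemma bounded_if_compact_support:
  fixes g :: "'a::euclidean_space \<Rightarrow> real"
  assumes "continuous_on UNIV g" "compact K" "\<And>x. x \<notin> K \<Longrightarrow> g x = 0"
  shows "\<exists>B\<ge>0. \<forall>x. \<bar>g x\<bar> \<le> B"
proof -
  have "bounded (g ` K)"
    using assms continuous_on_subset by (blast intro: compact_imp_bounded compact_continuous_image)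
  then obtain B where "\<And>x. x \<in> K \<Longrightarrow> \<bar>g x\<bar> \<le> B"
    by (auto simp: bounded_real)
  then have "\<bar>g x\<bar> \<le> \<bar>B\<bar>" for x
    using assms(3)[of x] by (cases "x \<in> K") (auto intro: order_trans[OF _ abs_ge_self])
  then show ?thesis by (intro exI[of _ "\<bar>B\<bar>"]) auto
qed

lemma Cc_inf_continuous: "\<phi> \<in> Cc_inf D \<Longrightarrow> continuous_on UNIV \<phi>"
  unfolding Cc_inf_def by (metis (mono_tags, lifting) C_k.simps(1) mem_Collect_eq)

lemma Cc_inf_measurable:
  assumes "\<phi> \<in> Cc_inf D"
  shows "\<phi> \<in> borel_measurable lebesgue"
  using borel_measurable_continuous_onI[OF Cc_inf_continuous[OF assms]]
  by (simp add: measurable_completion)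

lemma Cc_inf_bounded:
  assumes "\<phi> \<in> Cc_inf D"
  shows "\<exists>B\<ge>0. \<forall>x. \<bar>\<phi> x\<bar> \<le> B"
proof (rule bounded_if_compact_support[OF Cc_inf_continuous[OF assms]])
  show "compact (closure {x. \<phi> x \<noteq> 0})" using assms by (simp add: Cc_inf_def)
  show "\<phi> x = 0" if "x \<notin> closure {x. \<phi> x \<noteq> 0}" for x
    using that closure_subset[of "{x. \<phi> x \<noteq> 0}"] by auto
qed

text \<open>The partial derivatives are continuous and vanish off the support, hence are bounded.
  The sum of their bounds controls the operator norm, and the mean value inequality applies.\<close>

lemma Cc_inf_Lipschitz:
  fixes \<phi> :: "'a::euclidean_space \<Rightarrow> real"
  assumes "\<phi> \<in> Cc_inf D"
  shows "\<exists>L. \<forall>x y. \<bar>\<phi> x - \<phi> y\<bar> \<le> L * norm (x - y)"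
proof -
  define K where "K = closure {x. \<phi> x \<noteq> 0}"
  have K: "compact K" and "C_k (Suc 0) \<phi>" using assms by (auto simp: Cc_inf_def K_def)
  then have diff: "\<phi> differentiable (at x)"
    and cont: "i \<in> Basis \<Longrightarrow> continuous_on UNIV (\<lambda>x. frechet_derivative \<phi> (at x) i)" for x i
    by auto
  have D: "(\<phi> has_derivative frechet_derivative \<phi> (at x)) (at x)" for x
    using diff by (simp flip: frechet_derivative_works)
  have zero: "frechet_derivative \<phi> (at x) = (\<lambda>h. 0)" if "x \<notin> K" for x
  proof -
    have "(\<phi> has_derivative (\<lambda>h. 0)) (at x)"
    proof (rule has_derivative_transform_within_open[of "\<lambda>_. 0" _ _ _ "- K"])
      show "open (- K)" using K by (simp add: compact_imp_closed open_Compl)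
      show "0 = \<phi> y" if "y \<in> - K" for y
        using that closure_subset[of "{x. \<phi> x \<noteq> 0}"] by (auto simp: K_def)
    qed (use that in auto)
    then show ?thesis by (simp add: frechet_derivative_at[symmetric])
  qed
  have "\<exists>B\<ge>0. \<forall>x. \<bar>frechet_derivative \<phi> (at x) i\<bar> \<le> B" if "i \<in> Basis" for i
    by (rule bounded_if_compact_support[OF cont[OF that] K]) (simp add: zero)
  then obtain B where B: "\<And>i. i \<in> Basis \<Longrightarrow> 0 \<le> B i"
      "\<And>i x. i \<in> Basis \<Longrightarrow> \<bar>frechet_derivative \<phi> (at x) i\<bar> \<le> B i"
    by metis
  have "norm (\<phi> x - \<phi> y) \<le> (\<Sum>i\<in>Basis. B i) * norm (x - y)" for x y
  proof (rule differentiable_bound[of UNIV \<phi> "\<lambda>x. frechet_derivative \<phi> (at x)"])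
    fix x
    interpret F: bounded_linear "frechet_derivative \<phi> (at x)"
      using D by (rule has_derivative_bounded_linear)
    show "onorm (frechet_derivative \<phi> (at x)) \<le> (\<Sum>i\<in>Basis. B i)"
    proof (rule onorm_bound)
      show "0 \<le> (\<Sum>i\<in>Basis. B i)" using B by (intro sum_nonneg) auto
      fix h :: 'a
      have "frechet_derivative \<phi> (at x) h = frechet_derivative \<phi> (at x) (\<Sum>i\<in>Basis. (h \<bullet> i) *\<^sub>R i)"
        by (simp add: euclidean_representation)
      also have "\<dots> = (\<Sum>i\<in>Basis. (h \<bullet> i) * frechet_derivative \<phi> (at x) i)"
        by (simp add: F.sum F.scaleR)
      finally have "norm (frechet_derivative \<phi> (at x) h)
          \<le> (\<Sum>i\<in>Basis. norm ((h \<bullet> i) * frechet_derivative \<phi> (at x) i))"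
        using norm_sum by metis
      also have "\<dots> \<le> (\<Sum>i\<in>Basis. B i * norm h)"
      proof (rule sum_mono)
        fix i :: 'a
        assume i: "i \<in> Basis"
        show "norm ((h \<bullet> i) * frechet_derivative \<phi> (at x) i) \<le> B i * norm h"
          using mult_mono[OF Basis_le_norm[OF i, of h] B(2)[OF i, of x]]
          by (simp add: abs_mult mult.commute)
      qed
      finally show "norm (frechet_derivative \<phi> (at x) h) \<le> (\<Sum>i\<in>Basis. B i) * norm h"
        by (simp add: sum_distrib_right)
    qed
  qed (use D in auto)
  then show ?thesis by auto
qed

text \<open>The quotient vanishes unless one of the two points lies in the compact support
  \<open>K\<close>, so it is dominated by its products with \<open>indicator K\<close> in either
  variable; \<open>L2_mult_quot\<close> handles these.\<close>

lemma Cc_inf_in_Hs: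
  fixes \<phi> :: "'a::euclidean_space \<Rightarrow> real"
  assumes s: "0 < s" "s < 1" and \<phi>: "\<phi> \<in> Cc_inf D"
  shows "\<phi> \<in> Hs s"
proof -
  define K where "K = closure {x. \<phi> x \<noteq> 0}"
  obtain B L where B: "0 \<le> B" "\<And>x. \<bar>\<phi> x\<bar> \<le> B" and L: "\<And>x y. \<bar>\<phi> x - \<phi> y\<bar> \<le> L * norm (x - y)"
    using Cc_inf_bounded[OF \<phi>] Cc_inf_Lipschitz[OF \<phi>] by blast
  note m[measurable] = Cc_inf_measurable[OF \<phi>]
  have "compact K" using \<phi> by (simp add: Cc_inf_def K_def)
  then have ind: "(indicator K :: 'a \<Rightarrow> real) \<in> L2 lebesgue"
    using lmeasurable_compact[of K] by (intro L2_indicator) (auto simp: fmeasurable_def)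
  have zero: "\<phi> x = 0" if "x \<notin> K" for x
    using that closure_subset[of "{x. \<phi> x \<noteq> 0}"] by (auto simp: K_def)
  have "\<phi> \<in> L2 lebesgue"
    by (rule L2_mono[OF L2_cmult[OF ind, of B] m])
       (use B zero in \<open>auto simp: indicator_def\<close>)
  moreover have "quot s \<phi> \<in> L2 pair_lebesgue"
  proof (rule L2_mono)
    show "(\<lambda>z. \<bar>indicator K (snd z) * quot s \<phi> z\<bar> + \<bar>indicator K (fst z) * quot s \<phi> z\<bar>) \<in> L2 pair_lebesgue"
      by (intro L2_add L2_abs L2_mult_quot[OF s B(2) L m ind])
    show "AE z in pair_lebesgue. \<bar>quot s \<phi> z\<bar>
        \<le> \<bar>\<bar>indicator K (snd z) * quot s \<phi> z\<bar> + \<bar>indicator K (fst z) * quot s \<phi> z\<bar>\<bar>"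
    proof (rule AE_I2)
      fix z
      have "quot s \<phi> z = 0" if "fst z \<notin> K" "snd z \<notin> K"
        using that by (simp add: quot_def zero)
      then show "\<bar>quot s \<phi> z\<bar> \<le> \<bar>\<bar>indicator K (snd z) * quot s \<phi> z\<bar> + \<bar>indicator K (fst z) * quot s \<phi> z\<bar>\<bar>"
        by (cases "fst z \<in> K"; cases "snd z \<in> K") auto
    qed
  qed measurable
  ultimately show ?thesis by (simp add: Hs_iff_L2)
qed

lemma Cc_inf_in_Hs0:
  assumes "0 < s" "s < 1" "\<phi> \<in> Cc_inf D"
  shows "\<phi> \<in> Hs0 s D"
proof -
  have "\<phi> x = 0" if "x \<notin> D" for x
    using assms(3) that closure_subset[of "{x. \<phi> x \<noteq> 0}"] by (auto simp: Cc_inf_def)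
  then show ?thesis using Cc_inf_in_Hs[OF assms] by (simp add: Hs0_def)
qed

text \<open>A discrete Leibniz rule: the quotient of the product is \<open>\<eta>\<close> at the
  first point times that of \<open>u\<close>, plus \<open>u\<close> at the second point times that
  of \<open>\<eta>\<close>. Boundedness of \<open>\<eta>\<close> handles the first term,
  \<open>L2_mult_quot\<close> the second.\<close>

lemma Cc_inf_mult_in_Hs:
  fixes \<eta> :: "'a::euclidean_space \<Rightarrow> real"
  assumes s: "0 < s" "s < 1" and \<eta>: "\<eta> \<in> Cc_inf D" and u: "u \<in> Hs s"
  shows "(\<lambda>x. \<eta> x * u x) \<in> Hs s"
proof -
  obtain B L where B: "0 \<le> B" "\<And>x. \<bar>\<eta> x\<bar> \<le> B" and L: "\<And>x y. \<bar>\<eta> x - \<eta> y\<bar> \<le> L * norm (x - y)"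
    using Cc_inf_bounded[OF \<eta>] Cc_inf_Lipschitz[OF \<eta>] by blast
  note m[measurable] = Cc_inf_measurable[OF \<eta>] L2_measurable[OF Hs_L2[OF u]]
  note [measurable] = measurable_compose[OF measurable_fst m(1)] L2_measurable[OF Hs_quot_L2[OF u]]
  have bd: "\<bar>\<eta> x * c\<bar> \<le> \<bar>B * c\<bar>" for x c
    using B mult_right_mono[OF B(2), of "\<bar>c\<bar>" x] by (simp add: abs_mult)
  have "(\<lambda>x. \<eta> x * u x) \<in> L2 lebesgue"
    by (rule L2_mono[OF L2_cmult[OF Hs_L2[OF u], of B]]) (use bd in auto)
  moreover have "(\<lambda>z. \<eta> (fst z) * quot s u z) \<in> L2 pair_lebesgue"
    by (rule L2_mono[OF L2_cmult[OF Hs_quot_L2[OF u], of B]]) (use bd in auto)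
  then have "(\<lambda>z. \<eta> (fst z) * quot s u z + u (snd z) * quot s \<eta> z) \<in> L2 pair_lebesgue"
    by (intro L2_add L2_mult_quot[OF s B(2) L m(1) Hs_L2[OF u]])
  then have "quot s (\<lambda>x. \<eta> x * u x) \<in> L2 pair_lebesgue"
    by (rule back_subst[where P = "\<lambda>f. f \<in> L2 pair_lebesgue"])
       (auto simp: quot_def fun_eq_iff algebra_simps simp flip: add_divide_distrib)
  ultimately show ?thesis by (simp add: Hs_iff_L2)
qed

section \<open>Calculus of smooth functions\<close>

lemma C_k_Suc_imp: "C_k (Suc k) f \<Longrightarrow> C_k k f"
proof (induction k arbitrary: f)
  case 0
  then show ?case
    by (auto simp: continuous_on_eq_continuous_at intro: differentiable_imp_continuous_within)
next
  case (Suc k)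
  then show ?case by (subst (asm) C_k.simps(2)) simp
qed

lemma C_k_SucI:
  assumes "\<And>x. (f has_derivative f' x) (at x)" "\<And>i. i \<in> Basis \<Longrightarrow> C_k k (\<lambda>x. f' x i)"
  shows "C_k (Suc k) f"
proof -
  have "frechet_derivative f (at x) = f' x" for x
    using frechet_derivative_at[OF assms(1)] by simp
  then show ?thesis using assms by (auto simp: differentiable_def)
qed

lemma C_k_SucD:
  assumes "C_k (Suc k) f"
  shows "(f has_derivative frechet_derivative f (at x)) (at x)"
    and "i \<in> Basis \<Longrightarrow> C_k k (\<lambda>x. frechet_derivative f (at x) i)"
  using assms by (auto simp flip: frechet_derivative_works)

lemma C_k_const: "C_k k (\<lambda>x. c)"
proof (induction k arbitrary: c)
  case (Suc k)
  show ?case by (rule C_k_SucI[OF has_derivative_const]) (rule Suc)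
qed simp

lemma C_k_add: "C_k k f \<Longrightarrow> C_k k g \<Longrightarrow> C_k k (\<lambda>x. f x + g x)"
proof (induction k arbitrary: f g)
  case (Suc k)
  show ?case
    by (rule C_k_SucI[OF has_derivative_add[OF C_k_SucD(1)[OF Suc(2)] C_k_SucD(1)[OF Suc(3)]]])
       (intro Suc(1) C_k_SucD(2)[OF Suc(2)] C_k_SucD(2)[OF Suc(3)])
qed (auto intro: continuous_on_add)

lemma C_k_mult: "C_k k f \<Longrightarrow> C_k k g \<Longrightarrow> C_k k (\<lambda>x. f x * g x)"
proof (induction k arbitrary: f g)
  case (Suc k)
  show ?case
    by (rule C_k_SucI[OF has_derivative_mult[OF C_k_SucD(1)[OF Suc(2)] C_k_SucD(1)[OF Suc(3)]]])
       (intro C_k_add Suc(1) C_k_SucD(2)[OF Suc(2)] C_k_SucD(2)[OF Suc(3)]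
          C_k_Suc_imp[OF Suc(2)] C_k_Suc_imp[OF Suc(3)])
qed (auto intro: continuous_on_mult)

text \<open>The exponent is generalized in the induction since differentiation lowers it by one;
  positivity of \<open>f\<close> keeps every real power smooth.\<close>

lemma C_k_powr:
  assumes "C_k k f" "\<And>x. 0 < f x"
  shows "C_k k (\<lambda>x. f x powr a)"
  using assms
proof (induction k arbitrary: f a)
  case 0
  then show ?case by (auto intro!: continuous_on_powr simp: less_imp_neq[THEN not_sym])
next
  case (Suc k)
  show ?case
    by (rule C_k_SucI[OF DERIV_compose_FDERIV[OF has_real_derivative_powr[OF Suc(3)] C_k_SucD(1)[OF Suc(2)]]])
       (intro C_k_mult C_k_const Suc(1)[OF C_k_Suc_imp[OF Suc(2)] Suc(3)] C_k_SucD(2)[OF Suc(2)])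
qed

text \<open>A smooth substitute for the absolute value: adding \<open>e\<^sup>2\<close> keeps the
  root away from its singularity, and subtracting \<open>e\<close> restores the zero set of
  \<open>\<phi>\<close>, hence its support.\<close>

lemma Cc_inf_smooth_abs:
  assumes \<phi>: "\<phi> \<in> Cc_inf D" and e: "0 < e"
  shows "(\<lambda>x. sqrt ((\<phi> x)\<^sup>2 + e\<^sup>2) - e) \<in> Cc_inf D"
proof -
  have "C_k k (\<lambda>x. (\<phi> x * \<phi> x + e\<^sup>2) powr (1/2) + - e)" for k
    using \<phi> e by (intro C_k_add C_k_powr C_k_mult C_k_const) (auto simp: Cc_inf_def intro: add_nonneg_pos)
  moreover have "(\<phi> x * \<phi> x + e\<^sup>2) powr (1/2) + - e = sqrt ((\<phi> x)\<^sup>2 + e\<^sup>2) - e" for x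
    by (simp add: powr_half_sqrt power2_eq_square)
  ultimately have "C_k k (\<lambda>x. sqrt ((\<phi> x)\<^sup>2 + e\<^sup>2) - e)" for k by simp
  moreover have "sqrt ((\<phi> x)\<^sup>2 + e\<^sup>2) - e \<noteq> 0 \<longleftrightarrow> \<phi> x \<noteq> 0" for x
    using e real_sqrt_eq_iff[of "(\<phi> x)\<^sup>2 + e\<^sup>2" "e\<^sup>2"] by auto
  ultimately show ?thesis using \<phi> by (simp add: Cc_inf_def)
qed

section \<open>Nonnegative test functions\<close>

text \<open>The criterion for null sets of pairs asks for a measurable set of good pairs, so the
  exceptional set is first enlarged to a measurable null set \<open>N\<close>.\<close>

lemma AE_pair_lebesgue_both:
  fixes P :: "'a::euclidean_space \<Rightarrow> bool"
  assumes "AE x in lebesgue. P x"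
  shows "AE z in pair_lebesgue. P (fst z) \<and> P (snd z)"
proof -
  obtain N where N: "N \<in> null_sets lebesgue" "{x. \<not> P x} \<subseteq> N"
    using assms by (auto simp: eventually_ae_filter)
  then have [measurable]: "N \<in> sets lebesgue" by auto
  have ae: "AE x in lebesgue. x \<notin> N" by (rule AE_not_in[OF N(1)])
  have "AE z in pair_lebesgue. fst z \<notin> N \<and> snd z \<notin> N"
  proof (rule pair_lebesgue.AE_pair_measure)
    show "{z \<in> space pair_lebesgue. fst z \<notin> N \<and> snd z \<notin> N} \<in> sets pair_lebesgue"
      by measurable
    show "AE x in lebesgue. AE y in lebesgue. fst (x, y) \<notin> N \<and> snd (x, y) \<notin> N"
      using ae by eventually_elim (use ae in simp)
  qed
  then show ?thesis
    by eventually_elim (use N(2) in auto)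
qed

text \<open>Given \<open>\<phi>\<^sub>k \<rightarrow> v\<close> in norm with \<open>v \<ge> 0\<close>, take \<open>\<psi>\<^sub>k = sqrt (\<phi>\<^sub>k\<^sup>2 + e\<^sub>k\<^sup>2) - e\<^sub>k\<close> along a subsequence:
  a smooth contraction of \<open>\<phi>\<^sub>k\<close> with the same support. Being dominated by \<open>\<phi>\<^sub>k\<close> and its difference
  quotients, it converges weakly as soon as it converges almost everywhere.\<close>

lemma nonneg_test_functions_weakly_dense:
  fixes v :: "'a::euclidean_space \<Rightarrow> real"
  assumes s: "0 < s" "s < 1" and dense: "test_functions_dense s D"
    and v0: "v \<in> Hs0 s D" and nonneg: "\<And>x. 0 \<le> v x"
  obtains \<psi> where "\<And>k. \<psi> k \<in> Cc_inf D" "\<And>k x. 0 \<le> \<psi> k x"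
    "\<And>w. w \<in> Hs s \<Longrightarrow> (\<lambda>k. frac_lap s w (\<psi> k)) \<longlonglongrightarrow> frac_lap s w v"
    "\<And>h. h \<in> L2 lebesgue \<Longrightarrow> (\<lambda>k. \<integral> x. h x * \<psi> k x \<partial>lebesgue) \<longlonglongrightarrow> (\<integral> x. h x * v x \<partial>lebesgue)"
proof -
  have v: "v \<in> Hs s" by (rule Hs0_Hs[OF v0])
  define e where "e k = inverse (real (Suc k))" for k
  have e: "0 < e k" for k by (simp add: e_def)
  have e_lim: "e \<longlonglongrightarrow> 0" unfolding e_def by (rule LIMSEQ_inverse_real_of_nat)
  have "\<exists>\<phi>\<in>Cc_inf D. (\<integral>\<^sup>+ x. ennreal ((v x - \<phi> x)\<^sup>2) \<partial>lebesgue)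
      + gagliardo_sq s (\<lambda>x. v x - \<phi> x) < ennreal (e k)" for k
    using dense v0 e[of k] unfolding test_functions_dense_def by blast
  then obtain \<phi> where \<phi>: "\<And>k. \<phi> k \<in> Cc_inf D"
    and close: "\<And>k. (\<integral>\<^sup>+ x. ennreal ((v x - \<phi> k x)\<^sup>2) \<partial>lebesgue)
      + gagliardo_sq s (\<lambda>x. v x - \<phi> k x) < ennreal (e k)"
    by metis
  have \<phi>_Hs: "\<phi> k \<in> Hs s" for k by (rule Cc_inf_in_Hs[OF s \<phi>])
  have d: "(\<lambda>x. v x - \<phi> k x) \<in> Hs s" for k by (rule Hs_diff[OF v \<phi>_Hs])
  have le: "(\<integral> x. (v x - \<phi> k x)\<^sup>2 \<partial>lebesgue) \<le> e k"
      "(\<integral> z. (quot s (\<lambda>x. v x - \<phi> k x) z)\<^sup>2 \<partial>pair_lebesgue) \<le> e k" for k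
  proof -
    have "ennreal (\<integral> x. (v x - \<phi> k x)\<^sup>2 \<partial>lebesgue)
        + ennreal (\<integral> z. (quot s (\<lambda>x. v x - \<phi> k x) z)\<^sup>2 \<partial>pair_lebesgue) < ennreal (e k)"
      using close[of k] unfolding gagliardo_sq_quot L2_nn_integral[OF Hs_L2[OF d]]
        L2_nn_integral[OF Hs_quot_L2[OF d]] .
    then have "(\<integral> x. (v x - \<phi> k x)\<^sup>2 \<partial>lebesgue)
        + (\<integral> z. (quot s (\<lambda>x. v x - \<phi> k x) z)\<^sup>2 \<partial>pair_lebesgue) < e k"
      by (simp add: ennreal_less_iff flip: ennreal_plus)
    moreover have "0 \<le> (\<integral> x. (v x - \<phi> k x)\<^sup>2 \<partial>lebesgue)"
        "0 \<le> (\<integral> z. (quot s (\<lambda>x. v x - \<phi> k x) z)\<^sup>2 \<partial>pair_lebesgue)"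
      by simp_all
    ultimately show "(\<integral> x. (v x - \<phi> k x)\<^sup>2 \<partial>lebesgue) \<le> e k"
      "(\<integral> z. (quot s (\<lambda>x. v x - \<phi> k x) z)\<^sup>2 \<partial>pair_lebesgue) \<le> e k"
      by linarith+
  qed
  have lim1: "(\<lambda>k. \<integral> x. (\<phi> k x - v x)\<^sup>2 \<partial>lebesgue) \<longlonglongrightarrow> 0"
    by (rule tendsto_sandwich[OF _ _ tendsto_const e_lim])
       (use le(1) in \<open>auto simp: power2_commute[of "\<phi> _ _"]\<close>)
  have lim2: "(\<lambda>k. \<integral> z. (quot s (\<phi> k) z - quot s v z)\<^sup>2 \<partial>pair_lebesgue) \<longlonglongrightarrow> 0"
    by (rule tendsto_sandwich[OF _ _ tendsto_const e_lim])
       (use le(2) in \<open>auto simp: power2_commute[of "quot s (\<phi> _) _"] quot_diff\<close>)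
  \<comment> \<open>Mean square convergence yields pointwise convergence almost everywhere only
    along a subsequence.\<close>
  have "\<exists>r::nat\<Rightarrow>nat. strict_mono r \<and> (AE x in lebesgue. (\<lambda>k. (\<phi> (r k) x - v x)\<^sup>2) \<longlonglongrightarrow> 0)"
  proof (rule tendsto_L1_AE_subseq)
    show "integrable lebesgue (\<lambda>x. (\<phi> k x - v x)\<^sup>2)" for k
      by (rule L2_integrable_sq[OF L2_diff[OF Hs_L2[OF \<phi>_Hs] Hs_L2[OF v]]])
    show "(\<lambda>k. \<integral> x. norm ((\<phi> k x - v x)\<^sup>2) \<partial>lebesgue) \<longlonglongrightarrow> 0"
      using lim1 by simp
  qed
  then obtain r :: "nat \<Rightarrow> nat" where r: "strict_mono r"
    and ae: "AE x in lebesgue. (\<lambda>k. (\<phi> (r k) x - v x)\<^sup>2) \<longlonglongrightarrow> 0"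
    by blast
  define \<psi> where "\<psi> k x = sqrt ((\<phi> (r k) x)\<^sup>2 + (e k)\<^sup>2) - e k" for k x
  have \<psi>: "\<psi> k \<in> Cc_inf D" for k
    using Cc_inf_smooth_abs[OF \<phi> e] by (simp add: \<psi>_def[abs_def])
  have \<psi>_nonneg: "0 \<le> \<psi> k x" for k x
    using e[of k] by (simp add: \<psi>_def real_le_rsqrt)
  have contr: "\<bar>\<psi> k x - \<psi> k y\<bar> \<le> \<bar>\<phi> (r k) x - \<phi> (r k) y\<bar>" for k x y
  proof -
    \<comment> \<open>Triangle inequality in the plane for the vectors \<open>(b, c)\<close> and
      \<open>(a - b, 0)\<close>.\<close>
    have "sqrt (a\<^sup>2 + c\<^sup>2) \<le> sqrt (b\<^sup>2 + c\<^sup>2) + \<bar>a - b\<bar>" for a b c :: real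
      using real_sqrt_sum_squares_triangle_ineq[of b "a - b" c 0] by simp
    from this[of "\<phi> (r k) x" "e k" "\<phi> (r k) y"] this[of "\<phi> (r k) y" "e k" "\<phi> (r k) x"]
    show ?thesis by (simp add: \<psi>_def)
  qed
  have \<psi>_le: "\<bar>\<psi> k x\<bar> \<le> \<bar>\<phi> (r k) x\<bar>" for k x
    using sqrt_sum_squares_le_sum_abs[of "\<phi> (r k) x" "e k"] \<psi>_nonneg[of k x] e[of k]
    by (simp add: \<psi>_def)
  have ae_lim: "AE x in lebesgue. (\<lambda>k. \<psi> k x) \<longlonglongrightarrow> v x"
    using ae
  proof eventually_elim
    case (elim x)
    then have "(\<lambda>k. sqrt ((\<phi> (r k) x - v x)\<^sup>2)) \<longlonglongrightarrow> sqrt 0"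
      by (rule tendsto_real_sqrt)
    then have "(\<lambda>k. \<phi> (r k) x) \<longlonglongrightarrow> v x"
      by (simp add: tendsto_rabs_zero_iff LIM_zero_iff)
    \<comment> \<open>The limit is \<open>\<bar>v x\<bar>\<close>; here the sign of \<open>v\<close>
      enters.\<close>
    then have "(\<lambda>k. \<psi> k x) \<longlonglongrightarrow> sqrt ((v x)\<^sup>2 + 0\<^sup>2) - 0"
      unfolding \<psi>_def by (intro tendsto_intros e_lim)
    then show ?case using nonneg[of x] by simp
  qed
  show thesis
  proof (rule that[OF \<psi> \<psi>_nonneg])
    show "(\<lambda>k. \<integral> x. h x * \<psi> k x \<partial>lebesgue) \<longlonglongrightarrow> (\<integral> x. h x * v x \<partial>lebesgue)"
      if "h \<in> L2 lebesgue" for h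
      using LIMSEQ_subseq_LIMSEQ[OF lim1 r]
      by (intro L2_dominated_weak_limit[OF that Hs_L2[OF v] Hs_L2[OF \<phi>_Hs] _ Cc_inf_measurable[OF \<psi>] \<psi>_le ae_lim])
         (simp add: o_def)
    show "(\<lambda>k. frac_lap s w (\<psi> k)) \<longlonglongrightarrow> frac_lap s w v" if "w \<in> Hs s" for w
      unfolding frac_lap_quot
    proof (intro tendsto_mult_left)
      show "(\<lambda>k. \<integral> z. quot s w z * quot s (\<psi> k) z \<partial>pair_lebesgue)
          \<longlonglongrightarrow> (\<integral> z. quot s w z * quot s v z \<partial>pair_lebesgue)"
      proof (rule L2_dominated_weak_limit[OF Hs_quot_L2[OF that] Hs_quot_L2[OF v] Hs_quot_L2[OF \<phi>_Hs[of "r _"]]])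
        show "(\<lambda>k. \<integral> z. (quot s (\<phi> (r k)) z - quot s v z)\<^sup>2 \<partial>pair_lebesgue) \<longlonglongrightarrow> 0"
          using LIMSEQ_subseq_LIMSEQ[OF lim2 r] by (simp add: o_def)
        show "quot s (\<psi> k) \<in> borel_measurable pair_lebesgue" for k
          by (rule quot_measurable[OF Cc_inf_measurable[OF \<psi>]])
        show "\<bar>quot s (\<psi> k) z\<bar> \<le> \<bar>quot s (\<phi> (r k)) z\<bar>" for k z
          by (rule quot_mono[OF contr])
        show "AE z in pair_lebesgue. (\<lambda>k. quot s (\<psi> k) z) \<longlonglongrightarrow> quot s v z"
          using AE_pair_lebesgue_both[OF ae_lim]
          unfolding quot_def divide_inverse
          by eventually_elim (intro tendsto_mult_right tendsto_diff, blast+)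
      qed
    qed
  qed
qed

section \<open>The obstacle problem\<close>

text \<open>Saturation is the complementarity that drives the estimates: the source may fall below
  its maximal value 1 only where \<open>u\<close> has reached its ceiling
  \<open>\<alpha>\<close>.\<close>

locale saturated_source =
  fixes s \<alpha> \<beta> :: real and D :: "'a::euclidean_space set" and f u :: "'a \<Rightarrow> real"
  assumes s: "0 < s" "s < 1"
    and open_D: "open D"
    and f: "f \<in> R_bar D \<beta>"
    and weak: "weak_solution s D f u"
    and alpha: "0 < \<alpha>"
    and f_lt_1: "AE x in lebesgue. x \<in> D \<longrightarrow> f x < 1 \<longrightarrow> u x = \<alpha>"
    and u_le_alpha: "AE x in lebesgue. x \<in> D \<longrightarrow> u x \<le> \<alpha>"
begin

text \<open>Membership in \<open>R_bar\<close> says nothing about \<open>f\<close> outside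
  \<open>D\<close>; extension by zero turns set integrals into integrals over the whole
  space.\<close>

definition fD :: "'a \<Rightarrow> real" where
  "fD x = indicator D x * f x"

lemma D_sets[measurable]: "D \<in> sets lebesgue"
  using open_D by simp

lemma u_Hs0: "u \<in> Hs0 s D"
  using weak by (simp add: weak_solution_def)

lemma u_Hs: "u \<in> Hs s"
  by (rule Hs0_Hs[OF u_Hs0])

lemma f_bounds: "AE x in lebesgue. x \<in> D \<longrightarrow> 0 \<le> f x \<and> f x \<le> 1"
  using f by (simp add: R_bar_def)

lemma fD_integrable: "integrable lebesgue fD"
  and integral_fD: "(\<integral> x. fD x \<partial>lebesgue) = \<beta>"
  using f by (simp_all add: R_bar_def set_integrable_def set_lebesgue_integral_def fD_def[abs_def])

lemma fD_bounds: "AE x in lebesgue. 0 \<le> fD x \<and> fD x \<le> indicator D x"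
  using f_bounds by eventually_elim (auto simp: fD_def indicator_def)

lemma fD_eq_1: "AE x in lebesgue. x \<in> D \<longrightarrow> u x < \<alpha> \<longrightarrow> fD x = 1"
  using f_bounds f_lt_1 by eventually_elim (auto simp: fD_def)

lemma fD_L2: "fD \<in> L2 lebesgue"
proof -
  have [measurable]: "fD \<in> borel_measurable lebesgue"
    using fD_integrable by simp
  have "integrable lebesgue (\<lambda>x. (fD x)\<^sup>2)"
  proof (rule Bochner_Integration.integrable_bound[OF fD_integrable])
    show "AE x in lebesgue. norm ((fD x)\<^sup>2) \<le> norm (fD x)"
      using fD_bounds
    proof eventually_elim
      case (elim x)
      then have "fD x \<le> 1" by (cases "x \<in> D") auto
      with elim show ?case using mult_left_mono[of "fD x" 1 "fD x"] by (simp add: power2_eq_square)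
    qed
  qed measurable
  then show ?thesis by (simp add: L2_def)
qed

lemma frac_lap_u: "v \<in> Hs0 s D \<Longrightarrow> frac_lap s u v = (\<integral> x. fD x * v x \<partial>lebesgue)"
  using weak by (simp add: weak_solution_def set_lebesgue_integral_def fD_def mult.assoc)

text \<open>Almost everywhere in \<open>D\<close> either \<open>f = 1\<close> or
  \<open>u = \<alpha>\<close>, so \<open>fD + u\<^sup>2 / \<alpha>\<^sup>2\<close>, which is
  integrable, is at least 1 there.\<close>

lemma emeasure_D_finite: "emeasure lebesgue D < \<infinity>"
proof -
  note [measurable] = Hs_L2[OF u_Hs] fD_L2
  have int: "integrable lebesgue (\<lambda>x. fD x + (u x)\<^sup>2 / \<alpha>\<^sup>2)"
    by (intro Bochner_Integration.integrable_add fD_integrable integrable_divide_zero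
        L2_integrable_sq[OF Hs_L2[OF u_Hs]])
  have le: "AE x in lebesgue. norm (indicator D x :: real) \<le> norm (fD x + (u x)\<^sup>2 / \<alpha>\<^sup>2)"
    using f_bounds f_lt_1
  proof eventually_elim
    case (elim x)
    show ?case
    proof (cases "x \<in> D \<and> f x < 1")
      case True
      then show ?thesis using elim alpha by (simp add: fD_def)
    next
      case False
      then show ?thesis using elim by (auto simp: fD_def indicator_def)
    qed
  qed
  have "integrable lebesgue (indicator D :: 'a \<Rightarrow> real)"
    by (rule Bochner_Integration.integrable_bound[OF int _ le]) measurable
  then show ?thesis by (simp add: integrable_indicator_iff)
qed

lemma indicator_D_L2:
  assumes [measurable]: "A \<in> sets lebesgue"
  shows "(\<lambda>x. indicator D x * indicator A x) \<in> L2 lebesgue"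
proof (rule L2_mono[OF L2_indicator[OF D_sets emeasure_D_finite]])
  show "AE x in lebesgue. \<bar>indicator D x * indicator A x\<bar> \<le> \<bar>indicator D x :: real\<bar>"
    by (auto simp: indicator_def)
qed measurable

section \<open>The energy and its minimizer\<close>

lemma fD_max_nonneg: "AE x in lebesgue. 0 \<le> fD x * max (\<alpha> - w x) 0"
  using fD_bounds by eventually_elim simp

lemma integrable_fD_mult:
  assumes "w \<in> L2 lebesgue"
  shows "integrable lebesgue (\<lambda>x. fD x * (\<alpha> - w x))"
    and "integrable lebesgue (\<lambda>x. fD x * max (\<alpha> - w x) 0)"
proof -
  note [measurable] = assms fD_L2
  show i: "integrable lebesgue (\<lambda>x. fD x * (\<alpha> - w x))"
    using fD_integrable L2_integrable_mult[OF fD_L2 assms] by (simp add: right_diff_distrib)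
  show "integrable lebesgue (\<lambda>x. fD x * max (\<alpha> - w x) 0)"
    by (rule Bochner_Integration.integrable_bound[OF i]) (auto simp: abs_mult mult_left_mono)
qed

text \<open>The weak equation for \<open>u\<close> is tested with \<open>w\<close> itself; the
  constant contributes the total mass \<open>\<beta>\<close> of the source.\<close>

lemma integral_fD_mult:
  assumes "w \<in> Hs0 s D"
  shows "(\<integral> x. fD x * (\<alpha> - w x) \<partial>lebesgue) = \<alpha> * \<beta> - frac_lap s u w"
  using fD_integrable L2_integrable_mult[OF fD_L2 Hs_L2, of w s] assms
  by (simp add: right_diff_distrib frac_lap_u integral_fD Hs0_def)

lemma nn_integral_fD_mult:
  assumes "w \<in> L2 lebesgue"
  shows "(\<integral>\<^sup>+ x. ennreal (fD x * max (\<alpha> - w x) 0) \<partial>lebesgue)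
    = ennreal (\<integral> x. fD x * max (\<alpha> - w x) 0 \<partial>lebesgue)"
  by (rule nn_integral_eq_integral[OF integrable_fD_mult(2)[OF assms]])
     (rule fD_max_nonneg)

lemma J_const_minus:
  assumes "w \<in> Hs s"
  shows "J s D (\<lambda>x. \<alpha> - w x)
    = ennreal (frac_lap s w w / 2) + (\<integral>\<^sup>+ x\<in>D. ennreal (max (\<alpha> - w x) 0) \<partial>lebesgue)"
proof -
  have "1 / 4 * ennreal (2 * frac_lap s w w) = ennreal (1 / 4) * ennreal (2 * frac_lap s w w)"
    by (simp flip: ennreal_divide_numeral add: divide_ennreal_def)
  also have "\<dots> = ennreal (frac_lap s w w / 2)"
    by (simp flip: ennreal_mult')
  finally show ?thesis
    by (simp add: J_def gagliardo_sq_const_minus gagliardo_sq_eq_frac_lap[OF assms])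
qed

text \<open>Keeping the form of \<open>w - u\<close> on the left gives minimality and uniqueness
  from the same estimate.\<close>

lemma J_lower_bound:
  assumes w: "w \<in> Hs0 s D"
  shows "ennreal (\<alpha> * \<beta> - frac_lap s u u / 2 + frac_lap s (\<lambda>x. w x - u x) (\<lambda>x. w x - u x) / 2)
    \<le> J s D (\<lambda>x. \<alpha> - w x)"
proof -
  have w': "w \<in> Hs s" by (rule Hs0_Hs[OF w])
  define I where "I = (\<integral> x. fD x * max (\<alpha> - w x) 0 \<partial>lebesgue)"
  \<comment> \<open>Since \<open>fD\<close> is nonnegative, passing to the positive part can only
    increase the integral.\<close>
  have "(\<integral> x. fD x * (\<alpha> - w x) \<partial>lebesgue) \<le> I"
    unfolding I_def
    by (intro integral_mono_AE integrable_fD_mult Hs_L2[OF w'])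
       (use fD_bounds in eventually_elim, auto intro: mult_left_mono)
  then have "\<alpha> * \<beta> - frac_lap s u w \<le> I"
    by (simp add: integral_fD_mult[OF w])
  \<comment> \<open>Completing the square: \<open>frac_lap s w w / 2 - frac_lap s u w\<close> is
    half the form of \<open>w - u\<close> minus half the form of \<open>u\<close>.\<close>
  then have "ennreal (\<alpha> * \<beta> - frac_lap s u u / 2 + frac_lap s (\<lambda>x. w x - u x) (\<lambda>x. w x - u x) / 2)
      \<le> ennreal (frac_lap s w w / 2 + I)"
    by (intro ennreal_leI) (simp add: frac_lap_diff_self[OF u_Hs w'] field_simps)
  also have "\<dots> = ennreal (frac_lap s w w / 2) + ennreal I"
    by (rule ennreal_plus)
       (simp_all add: frac_lap_self_nonneg I_def integral_nonneg_AE fD_max_nonneg)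
  \<comment> \<open>Now the upper bound \<open>fD \<le> indicator D\<close> is used.\<close>
  also have "ennreal I \<le> (\<integral>\<^sup>+ x\<in>D. ennreal (max (\<alpha> - w x) 0) \<partial>lebesgue)"
    unfolding I_def nn_integral_fD_mult[OF Hs_L2[OF w'], symmetric]
  proof (rule nn_integral_mono_AE)
    show "AE x in lebesgue. ennreal (fD x * max (\<alpha> - w x) 0) \<le> ennreal (max (\<alpha> - w x) 0) * indicator D x"
      using fD_bounds
    proof eventually_elim
      case (elim x)
      then show ?case
        using mult_right_mono[of "fD x" "indicator D x" "max (\<alpha> - w x) 0"]
        by (auto simp: indicator_def intro!: ennreal_leI split: if_splits)
    qed
  qed
  finally show ?thesis
    by (simp add: J_const_minus[OF w'])
qed

text \<open>Both losses in the lower bound disappear for \<open>w = u\<close>: the positive part is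
  redundant because \<open>u \<le> \<alpha>\<close> in \<open>D\<close>, and \<open>fD\<close> may
  be replaced by 1 because it equals 1 wherever \<open>\<alpha> - u\<close> is positive.\<close>

lemma J_u: "J s D (\<lambda>x. \<alpha> - u x) = ennreal (\<alpha> * \<beta> - frac_lap s u u / 2)"
  and J_u_nonneg: "0 \<le> \<alpha> * \<beta> - frac_lap s u u / 2"
proof -
  define I where "I = (\<integral> x. fD x * max (\<alpha> - u x) 0 \<partial>lebesgue)"
  have I0: "0 \<le> I"
    unfolding I_def by (intro integral_nonneg_AE fD_max_nonneg)
  have "I = (\<integral> x. fD x * (\<alpha> - u x) \<partial>lebesgue)"
    unfolding I_def
    by (intro integral_cong_AE borel_measurable_integrable integrable_fD_mult Hs_L2[OF u_Hs])
       (use u_le_alpha in eventually_elim, auto simp: fD_def indicator_def)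
  then have I: "I = \<alpha> * \<beta> - frac_lap s u u"
    by (simp add: integral_fD_mult[OF u_Hs0])
  have "(\<integral>\<^sup>+ x\<in>D. ennreal (max (\<alpha> - u x) 0) \<partial>lebesgue) = ennreal I"
    unfolding I_def nn_integral_fD_mult[OF Hs_L2[OF u_Hs], symmetric]
    by (intro nn_integral_cong_AE)
       (use fD_eq_1 u_le_alpha in eventually_elim, auto simp: fD_def indicator_def max_def)
  then show "J s D (\<lambda>x. \<alpha> - u x) = ennreal (\<alpha> * \<beta> - frac_lap s u u / 2)"
    using frac_lap_self_nonneg[of s u] I0 by (simp add: J_const_minus[OF u_Hs] I flip: ennreal_plus)
  show "0 \<le> \<alpha> * \<beta> - frac_lap s u u / 2"
    using I0 frac_lap_self_nonneg[of s u] by (simp add: I)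
qed

lemma H_shift_E:
  assumes "U \<in> H_shift s D \<alpha>"
  obtains w where "w \<in> Hs0 s D" "U = (\<lambda>x. \<alpha> - w x)"
proof
  show "(\<lambda>x. - 1 * (U x - \<alpha>)) \<in> Hs0 s D"
    using assms unfolding H_shift_def by (intro Hs0_cmult) auto
qed simp

text \<open>A nonzero constant is not square integrable, but a cutoff \<open>\<eta>\<close> turns it
  into a test function and \<open>u\<close> into a product covered by
  \<open>Cc_inf_mult_in_Hs\<close>.\<close>

lemma const_minus_u_in_H_shift: "(\<lambda>x. \<alpha> - u x) \<in> H_shift s D \<alpha>"
proof -
  have "(\<lambda>x. \<eta> x * (\<alpha> - u x)) \<in> Hs s" if "\<eta> \<in> Cc_inf UNIV" for \<eta>
    using Hs_diff[OF Hs_cmult[OF Cc_inf_in_Hs[OF s that], of \<alpha>] Cc_inf_mult_in_Hs[OF s that u_Hs]]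
    by (simp add: algebra_simps)
  then show ?thesis
    using Hs0_cmult[OF u_Hs0, of "-1"] by (simp add: H_shift_def Hs_loc_def)
qed

lemma minimizes: "minimizes_over (J s D) (H_shift s D \<alpha>) (\<lambda>x. \<alpha> - u x)"
  unfolding minimizes_over_def
proof (intro conjI ballI const_minus_u_in_H_shift)
  fix U assume "U \<in> H_shift s D \<alpha>"
  then obtain w where w: "w \<in> Hs0 s D" "U = (\<lambda>x. \<alpha> - w x)" by (rule H_shift_E)
  have "J s D (\<lambda>x. \<alpha> - u x) \<le> ennreal (\<alpha> * \<beta> - frac_lap s u u / 2
      + frac_lap s (\<lambda>x. w x - u x) (\<lambda>x. w x - u x) / 2)"
    unfolding J_u by (intro ennreal_leI) (simp add: frac_lap_self_nonneg)
  also have "\<dots> \<le> J s D U" unfolding w(2) by (rule J_lower_bound[OF w(1)])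
  finally show "J s D (\<lambda>x. \<alpha> - u x) \<le> J s D U" .
qed

lemma minimizer_unique:
  assumes "minimizes_over (J s D) (H_shift s D \<alpha>) U"
  shows "AE x in lebesgue. U x = \<alpha> - u x"
proof -
  have "U \<in> H_shift s D \<alpha>" and le: "J s D U \<le> J s D (\<lambda>x. \<alpha> - u x)"
    using assms const_minus_u_in_H_shift by (auto simp: minimizes_over_def)
  then obtain w where w: "w \<in> Hs0 s D" "U = (\<lambda>x. \<alpha> - w x)" by (auto elim: H_shift_E)
  have "ennreal (\<alpha> * \<beta> - frac_lap s u u / 2 + frac_lap s (\<lambda>x. w x - u x) (\<lambda>x. w x - u x) / 2)
      \<le> ennreal (\<alpha> * \<beta> - frac_lap s u u / 2)"
    using J_lower_bound[OF w(1)] le unfolding w(2) J_u by (rule order_trans)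
  \<comment> \<open>\<open>ennreal\<close> sends negative reals to 0, so cancelling it requires the
    minimal value to be nonnegative.\<close>
  then have "frac_lap s (\<lambda>x. w x - u x) (\<lambda>x. w x - u x) \<le> 0"
    using J_u_nonneg by simp
  moreover have "(\<lambda>x. w x - u x) \<in> Hs s"
    by (rule Hs0_Hs[OF Hs0_diff[OF w(1) u_Hs0]])
  ultimately have "AE x in lebesgue. w x - u x = 0"
    by (intro Hs_AE_zero_if_frac_lap_nonpos)
  then show ?thesis by eventually_elim (simp add: w(2))
qed

section \<open>The obstacle inequalities and comparison\<close>

lemma obstacle_ineqs_u: "obstacle_ineqs s D (\<lambda>x. \<alpha> - u x)"
  unfolding obstacle_ineqs_def set_lebesgue_integral_def frac_lap_const_minus
proof (intro ballI impI)
  fix \<phi> :: "'a \<Rightarrow> real"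
  assume \<phi>: "\<phi> \<in> Cc_inf D" and nonneg: "\<forall>x. 0 \<le> \<phi> x"
  have \<phi>0: "\<phi> \<in> Hs0 s D" by (rule Cc_inf_in_Hs0[OF s \<phi>])
  then have \<phi>2: "\<phi> \<in> L2 lebesgue" by (intro Hs_L2 Hs0_Hs)
  have "(\<integral> x. indicator D x * indicator {x. 0 < \<alpha> - u x} x * \<phi> x \<partial>lebesgue) \<le> frac_lap s u \<phi>"
    unfolding frac_lap_u[OF \<phi>0]
  proof (intro integral_mono_AE L2_integrable_mult \<phi>2 fD_L2 indicator_D_L2)
    show "{x. 0 < \<alpha> - u x} \<in> sets lebesgue"
      by (rule sets_lebesgue_sublevel[OF L2_measurable[OF Hs_L2[OF u_Hs]]])
    \<comment> \<open>Saturation gives \<open>fD = 1\<close> on the part of \<open>D\<close> where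
      \<open>u < \<alpha>\<close>.\<close>
    show "AE x in lebesgue. indicator D x * indicator {x. 0 < \<alpha> - u x} x * \<phi> x \<le> fD x * \<phi> x"
      using fD_bounds fD_eq_1
      by eventually_elim (auto simp: indicator_def nonneg split: if_splits)
  qed
  moreover have "frac_lap s u \<phi> \<le> (\<integral> x. indicator D x * indicator {x. 0 \<le> \<alpha> - u x} x * \<phi> x \<partial>lebesgue)"
    unfolding frac_lap_u[OF \<phi>0]
  proof (intro integral_mono_AE L2_integrable_mult \<phi>2 fD_L2 indicator_D_L2)
    show "{x. 0 \<le> \<alpha> - u x} \<in> sets lebesgue"
      by (rule sets_lebesgue_sublevel[OF L2_measurable[OF Hs_L2[OF u_Hs]]])
    \<comment> \<open>The upper indicator is 1 almost everywhere in \<open>D\<close>, as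
      \<open>u \<le> \<alpha>\<close> there.\<close>
    show "AE x in lebesgue. fD x * \<phi> x \<le> indicator D x * indicator {x. 0 \<le> \<alpha> - u x} x * \<phi> x"
      using fD_bounds u_le_alpha
    proof eventually_elim
      case (elim x)
      then show ?case
        using nonneg mult_right_mono[of "fD x" "indicator D x" "\<phi> x"]
        by (auto simp: indicator_def split: if_splits)
    qed
  qed
  ultimately show "(\<integral> x. indicator D x *\<^sub>R (indicator {x. 0 < \<alpha> - u x} x * \<phi> x) \<partial>lebesgue) \<le> - (- frac_lap s u \<phi>)
      \<and> - (- frac_lap s u \<phi>) \<le> (\<integral> x. indicator D x *\<^sub>R (indicator {x. 0 \<le> \<alpha> - u x} x * \<phi> x) \<partial>lebesgue)"
    by (simp add: mult.assoc)
qed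

text \<open>The comparison functions are not smooth, so the inequalities are carried over by weak
  limits of nonnegative test functions. The indicators define continuous functionals because
  \<open>D\<close> has finite measure.\<close>

lemma obstacle_ineqs_extend:
  assumes dense: "test_functions_dense s D" and w: "w \<in> Hs0 s D"
    and ineqs: "obstacle_ineqs s D (\<lambda>x. \<alpha> - w x)"
    and v: "v \<in> Hs0 s D" "\<And>x. 0 \<le> v x"
  shows "(\<integral> x. indicator D x * indicator {x. 0 < \<alpha> - w x} x * v x \<partial>lebesgue) \<le> frac_lap s w v"
    and "frac_lap s w v \<le> (\<integral> x. indicator D x * indicator {x. 0 \<le> \<alpha> - w x} x * v x \<partial>lebesgue)"
proof -
  have w': "w \<in> Hs s" by (rule Hs0_Hs[OF w])
  obtain \<psi> where \<psi>: "\<And>k. \<psi> k \<in> Cc_inf D" "\<And>k x. 0 \<le> \<psi> k x"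
    and lim: "\<And>w. w \<in> Hs s \<Longrightarrow> (\<lambda>k. frac_lap s w (\<psi> k)) \<longlonglongrightarrow> frac_lap s w v"
      "\<And>h. h \<in> L2 lebesgue \<Longrightarrow> (\<lambda>k. \<integral> x. h x * \<psi> k x \<partial>lebesgue) \<longlonglongrightarrow> (\<integral> x. h x * v x \<partial>lebesgue)"
    using nonneg_test_functions_weakly_dense[OF s dense v] by blast
  have le: "(\<integral> x. indicator D x * indicator {x. 0 < \<alpha> - w x} x * \<psi> k x \<partial>lebesgue) \<le> frac_lap s w (\<psi> k)"
    "frac_lap s w (\<psi> k) \<le> (\<integral> x. indicator D x * indicator {x. 0 \<le> \<alpha> - w x} x * \<psi> k x \<partial>lebesgue)" for k
    using ineqs \<psi> unfolding obstacle_ineqs_def set_lebesgue_integral_def frac_lap_const_minus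
    by (simp_all add: mult.assoc)
  show "(\<integral> x. indicator D x * indicator {x. 0 < \<alpha> - w x} x * v x \<partial>lebesgue) \<le> frac_lap s w v"
  proof (rule LIMSEQ_le[OF lim(2) lim(1)[OF w']])
    show "(\<lambda>x. indicator D x * indicator {x. 0 < \<alpha> - w x} x) \<in> L2 lebesgue"
      by (intro indicator_D_L2 sets_lebesgue_sublevel L2_measurable Hs_L2[OF w'])
  qed (use le in auto)
  show "frac_lap s w v \<le> (\<integral> x. indicator D x * indicator {x. 0 \<le> \<alpha> - w x} x * v x \<partial>lebesgue)"
  proof (rule LIMSEQ_le[OF lim(1)[OF w'] lim(2)])
    show "(\<lambda>x. indicator D x * indicator {x. 0 \<le> \<alpha> - w x} x) \<in> L2 lebesgue"
      by (intro indicator_D_L2 sets_lebesgue_sublevel L2_measurable Hs_L2[OF w'])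
  qed (use le in auto)
qed

text \<open>By \<open>frac_lap_positive_part_le\<close> the form of the positive part on itself is
  then nonpositive, so the positive part vanishes.\<close>

lemma AE_le_if_frac_lap_positive_part:
  assumes "g \<in> Hs0 s D" "frac_lap s g (\<lambda>x. max (g x) 0) \<le> 0"
  shows "AE x in lebesgue. g x \<le> 0"
proof -
  have g: "g \<in> Hs s" "(\<lambda>x. max (g x) 0) \<in> Hs s"
    by (intro Hs0_Hs[OF assms(1)] Hs0_Hs[OF Hs0_positive_part[OF assms(1)]])+
  have "AE x in lebesgue. max (g x) 0 = 0"
    by (rule Hs_AE_zero_if_frac_lap_nonpos[OF g(2) order_trans[OF frac_lap_positive_part_le[OF g] assms(2)]])
  then show ?thesis by eventually_elim simp
qed

text \<open>Comparison: the two inequalities are tested with \<open>(w - u)\<^sup>+\<close> and \<open>(u - w)\<^sup>+\<close>. Where the first is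
  positive and \<open>w \<le> \<alpha>\<close>, also \<open>u < \<alpha>\<close>, so \<open>f = 1\<close>; where the second is positive, \<open>w < u \<le> \<alpha>\<close>.\<close>

lemma obstacle_ineqs_unique:
  assumes dense: "test_functions_dense s D" and U: "U \<in> H_shift s D \<alpha>" "obstacle_ineqs s D U"
  shows "AE x in lebesgue. U x = \<alpha> - u x"
proof -
  obtain w where w: "w \<in> Hs0 s D" and Uw: "U = (\<lambda>x. \<alpha> - w x)"
    using U(1) by (rule H_shift_E)
  have w': "w \<in> Hs s" by (rule Hs0_Hs[OF w])
  have Hs0_L2: "v \<in> L2 lebesgue" if "v \<in> Hs0 s D" for v
    by (rule Hs_L2[OF Hs0_Hs[OF that]])
  note ext = obstacle_ineqs_extend[OF dense w U(2)[unfolded Uw]]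
  let ?p = "\<lambda>x. max (w x - u x) 0" and ?m = "\<lambda>x. max (u x - w x) 0"
  have p: "?p \<in> Hs0 s D" and m: "?m \<in> Hs0 s D"
    by (intro Hs0_positive_part Hs0_diff w u_Hs0)+
  then have p': "?p \<in> Hs s" and m': "?m \<in> Hs s" by (auto intro: Hs0_Hs)
  have "frac_lap s w ?p \<le> (\<integral> x. indicator D x * indicator {x. 0 \<le> \<alpha> - w x} x * ?p x \<partial>lebesgue)"
    by (rule ext(2)[OF p]) simp
  also have "\<dots> \<le> frac_lap s u ?p"
    unfolding frac_lap_u[OF p]
  proof (intro integral_mono_AE L2_integrable_mult Hs0_L2[OF p] fD_L2 indicator_D_L2)
    show "{x. 0 \<le> \<alpha> - w x} \<in> sets lebesgue"
      by (rule sets_lebesgue_sublevel[OF L2_measurable[OF Hs_L2[OF w']]])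
    show "AE x in lebesgue. indicator D x * indicator {x. 0 \<le> \<alpha> - w x} x * ?p x \<le> fD x * ?p x"
      using fD_bounds fD_eq_1
    proof eventually_elim
      case (elim x)
      show ?case
      proof (cases "x \<in> D \<and> w x \<le> \<alpha> \<and> u x < w x")
        case True
        then show ?thesis using elim by simp
      next
        case False
        then have zero: "indicator D x * indicator {x. 0 \<le> \<alpha> - w x} x * ?p x = 0"
          by (auto simp: indicator_def)
        show ?thesis unfolding zero using elim by simp
      qed
    qed
  qed
  \<comment> \<open>Subtracting the two ends, the form of \<open>w - u\<close> against its own
    positive part is nonpositive.\<close>
  finally have "AE x in lebesgue. w x - u x \<le> 0"
    by (intro AE_le_if_frac_lap_positive_part Hs0_diff w u_Hs0)
       (simp add: frac_lap_diff_left[OF w' u_Hs p'])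
  moreover have "frac_lap s u ?m \<le> (\<integral> x. indicator D x * indicator {x. 0 < \<alpha> - w x} x * ?m x \<partial>lebesgue)"
    unfolding frac_lap_u[OF m]
  proof (intro integral_mono_AE L2_integrable_mult Hs0_L2[OF m] fD_L2 indicator_D_L2)
    show "{x. 0 < \<alpha> - w x} \<in> sets lebesgue"
      by (rule sets_lebesgue_sublevel[OF L2_measurable[OF Hs_L2[OF w']]])
    show "AE x in lebesgue. fD x * ?m x \<le> indicator D x * indicator {x. 0 < \<alpha> - w x} x * ?m x"
      using fD_bounds u_le_alpha
    proof eventually_elim
      case (elim x)
      show ?case
      proof (cases "x \<in> D \<and> w x < u x")
        case True
        then show ?thesis using elim mult_right_mono[of "fD x" 1 "?m x"] by simp
      next
        case False
        then show ?thesis using elim by (auto simp: indicator_def fD_def)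
      qed
    qed
  qed
  then have "frac_lap s u ?m \<le> frac_lap s w ?m"
    by (rule order_trans) (rule ext(1)[OF m], simp)
  then have "AE x in lebesgue. u x - w x \<le> 0"
    by (intro AE_le_if_frac_lap_positive_part Hs0_diff w u_Hs0)
       (simp add: frac_lap_diff_left[OF u_Hs w' m'])
  ultimately show ?thesis
    by eventually_elim (simp add: Uw)
qed

end

text \<open>The inequalities see only smooth functions compactly supported in \<open>D\<close>,
  whereas comparison tests with positive parts from \<open>Hs0 s D\<close>; density bridges this gap
  and therefore appears as a premise of the last uniqueness claim. Uniqueness is up to null sets,
  since functions stand for their classes.\<close>

theorem theorem5p1:
  fixes s \<alpha> \<beta> :: real
    and D :: "(real ^ 'n) set"
    and fhat uhat :: "real ^ 'n \<Rightarrow> real"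
  assumes s: "0 < s" "s < 1"
    and domain: "open D" "connected D"
    and beta: "0 < \<beta>" "ennreal \<beta> < emeasure lebesgue D"
    and fhat: "minimizes_over (Phi s D) (R_bar D \<beta>) fhat"
    and uhat: "weak_solution s D fhat uhat"
    and alpha: "0 < \<alpha>"
    and f_lt_1: "AE x in lebesgue. x \<in> D \<longrightarrow> fhat x < 1 \<longrightarrow> uhat x = \<alpha>"
    and u_lt_alpha: "AE x in lebesgue. x \<in> D \<longrightarrow> uhat x < \<alpha> \<longrightarrow> fhat x = 1"
    and f_pos: "AE x in lebesgue. x \<in> D \<longrightarrow> 0 < fhat x"
    and u_bounds: "AE x in lebesgue. x \<in> D \<longrightarrow> 0 \<le> uhat x \<and> uhat x \<le> \<alpha>"
  defines "Uhat \<equiv> (\<lambda>x. \<alpha> - uhat x)"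
  shows "minimizes_over (J s D) (H_shift s D \<alpha>) Uhat
    \<and> obstacle_ineqs s D Uhat
    \<and> (\<forall>U. minimizes_over (J s D) (H_shift s D \<alpha>) U \<longrightarrow> (AE x in lebesgue. U x = Uhat x))
    \<and> (test_functions_dense s D \<longrightarrow>
         (\<forall>U\<in>H_shift s D \<alpha>. obstacle_ineqs s D U \<longrightarrow> (AE x in lebesgue. U x = Uhat x)))"
proof -
  have "fhat \<in> R_bar D \<beta>" using fhat by (simp add: minimizes_over_def)
  moreover have "AE x in lebesgue. x \<in> D \<longrightarrow> uhat x \<le> \<alpha>"
    using u_bounds by eventually_elim simp
  ultimately interpret saturated_source s \<alpha> \<beta> D fhat uhat
    using s domain(1) uhat alpha f_lt_1 by unfold_locales
  show ?thesis
    unfolding Uhat_def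
    using minimizes obstacle_ineqs_u minimizer_unique obstacle_ineqs_unique by blast
qed

end
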